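(* For all $n\geq1$, \[ P_{n}^{(\mathrm{lpk},\mathrm{ipk})}(s,t) =\frac{1}{n!}\sum_{k=0}^n d(n,k)\left((1-s)(1-t)\right)^{\frac{n-k}{2}}P_{k}^{\mathrm{lpk}}(s)P_{k}^{\mathrm{pk}}(t), \] where $P_{n}^{(\mathrm{lpk},\mathrm{ipk})}(s,t)=\sum_{\pi\in\mathfrak{S}_{n}}s^{\mathrm{lpk}(\pi)}t^{\mathrm{ipk}(\pi)+1}$.
   Context: $\mathfrak{S}_n$ is the symmetric group on $[n]$. For $\pi\in\mathfrak{S}_n$: $i$ with $2\le i\le n-1$ is a peak if $\pi(i-1)<\pi(i)>\pi(i+1)$, $\mathrm{pk}(\pi)$ the number of peaks, $\mathrm{ipk}(\pi)=\mathrm{pk}(\pi^{-1})$; $i\in[n-1]$ is a left peak if $i$ is a peak or if $i=1$ and $\pi(1)>\pi(2)$, $\mathrm{lpk}(\pi)$ the number of left peaks. $P_n^{\mathrm{pk}}(t)=\sum_{\pi\in\mathfrak{S}_n}t^{\mathrm{pk}(\pi)+1}$ and $P_n^{\mathrm{lpk}}(t)=\sum_{\pi\in\mathfrak{S}_n}t^{\mathrm{lpk}(\pi)}$ for $n\ge 1$, both equal to $1$ for $n=0$. $d(n,k)$ is the number of permutations in $\mathfrak{S}_n$ with exactly $k$ cycles, all of odd length (with $d(0,0)=1$); $d(n,k)=0$ if $n-k$ is odd. *)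

theory Defs
  imports Complex_Main "HOL-Combinatorics.Permutations" "HOL-Combinatorics.Orbits"
begin

definition perms :: "nat \<Rightarrow> (nat \<Rightarrow> nat) set" where
  "perms n = {\<pi>. \<pi> permutes {1..n}}"

definition is_peak :: "nat \<Rightarrow> (nat \<Rightarrow> nat) \<Rightarrow> nat \<Rightarrow> bool" where
  "is_peak n \<pi> i \<longleftrightarrow> 2 \<le> i \<and> i \<le> n - 1 \<and> \<pi> (i - 1) < \<pi> i \<and> \<pi> i > \<pi> (i + 1)"

definition pk :: "nat \<Rightarrow> (nat \<Rightarrow> nat) \<Rightarrow> nat" where
  "pk n \<pi> = card {i. is_peak n \<pi> i}"

definition ipk :: "nat \<Rightarrow> (nat \<Rightarrow> nat) \<Rightarrow> nat" where
  "ipk n \<pi> = pk n (inv \<pi>)"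

definition is_left_peak :: "nat \<Rightarrow> (nat \<Rightarrow> nat) \<Rightarrow> nat \<Rightarrow> bool" where
  "is_left_peak n \<pi> i \<longleftrightarrow> i \<in> {1..n - 1} \<and> (is_peak n \<pi> i \<or> i = 1 \<and> \<pi> 1 > \<pi> 2)"

definition lpk :: "nat \<Rightarrow> (nat \<Rightarrow> nat) \<Rightarrow> nat" where
  "lpk n \<pi> = card {i. is_left_peak n \<pi> i}"

text \<open>
  The polynomials are given by their values at elements of an arbitrary commutative ring (or
  semiring). An identity between such values that holds at all elements of all fields of
  characteristic 0 contains the formal identity: take the indeterminates themselves, as
  elements of a field of rational functions.
\<close>

definition P_pk :: "nat \<Rightarrow> 'a::comm_semiring_1 \<Rightarrow> 'a" where
  "P_pk n t = (if n = 0 then 1 else \<Sum>\<pi>\<in>perms n. t ^ (pk n \<pi> + 1))"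

definition P_lpk :: "nat \<Rightarrow> 'a::comm_semiring_1 \<Rightarrow> 'a" where
  "P_lpk n t = (if n = 0 then 1 else \<Sum>\<pi>\<in>perms n. t ^ lpk n \<pi>)"

definition P_lpk_ipk :: "nat \<Rightarrow> 'a::comm_semiring_1 \<Rightarrow> 'a \<Rightarrow> 'a" where
  "P_lpk_ipk n s t = (\<Sum>\<pi>\<in>perms n. s ^ lpk n \<pi> * t ^ (ipk n \<pi> + 1))"

text \<open>Cycles are identified with their supports; fixed points count as cycles of length 1.\<close>

definition perm_cycles :: "nat \<Rightarrow> (nat \<Rightarrow> nat) \<Rightarrow> nat set set" where
  "perm_cycles n \<pi> = orbit \<pi> ` {1..n}"

definition d :: "nat \<Rightarrow> nat \<Rightarrow> nat" where
  "d n k = card {\<pi> \<in> perms n. card (perm_cycles n \<pi>) = k \<and> (\<forall>C\<in>perm_cycles n \<pi>. odd (card C))}"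

end

theory Submission
  imports Defs "HOL-Computational_Algebra.Polynomial_FPS" "HOL-Library.FuncSet"
begin

text \<open>
  For a permutation \<open>\<pi>\<close> let \<open>U\<^sub>\<pi>(k)\<close> be the number of words \<open>f 1 \<le> \<dots> \<le> f n\<close> with letters in
  \<open>{0..2k}\<close> in which an even letter may be repeated only along ascents of \<open>\<pi>\<close> and an odd one
  only along descents; \<open>V\<^sub>\<pi>(l)\<close> is the same with letters in \<open>{1..2l}\<close>. These are the left
  enriched and the enriched order polynomials of Petersen and Stembridge: their generating
  functions in \<open>k\<close> and \<open>l\<close> are \<open>R\<^sup>n S^(lpk \<pi>) / (1 - X)\<close> and \<open>R\<^sup>n R S^(pk \<pi> + 1) / 2\<close>, where
  \<open>R = (1 + X) / (1 - X)\<close> and \<open>S = 4 X / (1 + X)\<^sup>2\<close>.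

  Standardization of words gives \<open>\<Sum>\<^sub>\<pi> U\<^sub>\<pi>(k) = (2k + 1)\<^sup>n\<close> and \<open>\<Sum>\<^sub>\<pi> V\<^sub>\<pi>(l) = (2l)\<^sup>n\<close>, and it turns
  \<open>\<Sum>\<^sub>\<pi> U\<^sub>\<pi>(k) V(l)\<close> with \<open>V\<close> taken at the inverse of \<open>\<pi>\<close> into a count of pairs of words, which
  equals \<open>V(l (2k + 1))\<close> at the identity. The latter is \<open>1 / n! \<Sum>\<^sub>j d(n,j) (2l)\<^sup>j (2k + 1)\<^sup>j\<close>.
  Expanding the powers again and comparing generating functions, first in \<open>k\<close> and then in \<open>l\<close>,
  gives the theorem because \<open>R\<^sup>2 (1 - S) = 1\<close> and \<open>S\<close> is transcendental.
\<close>

unbundle fps_syntax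

section \<open>Permutations with odd cycles only\<close>

definition odd_cycle_perms :: "'a set \<Rightarrow> nat \<Rightarrow> ('a \<Rightarrow> 'a) set" where
  "odd_cycle_perms S k =
    {p. p permutes S \<and> card (orbit p ` S) = k \<and> (\<forall>C\<in>orbit p ` S. odd (card C))}"

text \<open>For \<open>b\<close> in \<open>S\<close> the cycle through \<open>b\<close> is even and
  all others are odd. This shape is left when a moved point with predecessor \<open>b\<close> is
  deleted from a permutation with odd cycles only.\<close>

definition even_cycle_perms :: "'a set \<Rightarrow> nat \<Rightarrow> 'a \<Rightarrow> ('a \<Rightarrow> 'a) set" where
  "even_cycle_perms S k b =
    {p. p permutes S \<and> card (orbit p ` S) = k \<and> (\<forall>C\<in>orbit p ` S. odd (card C) \<longleftrightarrow> b \<notin> C)}"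

section \<open>Insertion of a point into a cycle\<close>

text \<open>An orbit starts with \<open>f x\<close> and not with \<open>x\<close>, hence the form of
  the first assumption.\<close>

lemma orbit_closed_subset:
  assumes "f x \<in> B" "\<And>y. y \<in> B \<Longrightarrow> f y \<in> B"
  shows "orbit f x \<subseteq> B"
proof
  fix z assume "z \<in> orbit f x"
  then show "z \<in> B" by induction (use assms in auto)
qed

lemma permutes_self_in_orbit:
  assumes "p permutes S" "finite S"
  shows "x \<in> orbit p x"
  using assms by (intro permutation_self_in_orbit) (auto simp: permutation_permutes)

lemma orbit_eq_of_mem:
  assumes "p permutes S" "finite S" "y \<in> orbit p x"
  shows "orbit p y = orbit p x"
  by (rule orbit_cyclic_eq3[OF cyclic_on_orbit[OF assms(1,2)] assms(3)])

text \<open>Composing with the transposition of \<open>b\<close> and a new point \<open>x\<close> inserts \<open>x\<close> after \<open>b\<close>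
  in its cycle.\<close>

lemma orbit_insert_point:
  fixes q :: "'a \<Rightarrow> 'a"
  assumes q: "q permutes S" and S: "finite S" and x: "x \<notin> S" and b: "b \<in> S" and y: "y \<in> S"
  defines "p \<equiv> q \<circ> transpose b x"
  shows "orbit p y = (if b \<in> orbit q y then insert x (orbit q y) else orbit q y)"
proof -
  have qx: "q x = x" using q x by (simp add: permutes_not_in)
  have pb: "p b = x" and px: "p x = q b" using qx by (auto simp: p_def)
  have po: "p z = q z" if "z \<noteq> b" "z \<noteq> x" for z using that by (simp add: p_def transpose_def)
  have sub: "orbit q y \<subseteq> S" using permutes_orbit_subset[OF q y] .
  have bx: "b \<noteq> x" using b x by auto
  \<comment> \<open>A step of \<open>q\<close> from a point other than \<open>b\<close> is a step of
    \<open>p\<close>; the step from \<open>b\<close> becomes the detour over \<open>x\<close> to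
    \<open>q b\<close>.\<close>
  have step: "q z \<in> orbit p y" if "z = y \<or> z \<in> orbit p y" "z \<in> S" for z
  proof (cases "z = b")
    case True
    then have "x \<in> orbit p y" using that pb by (metis orbit.intros)
    then show ?thesis using px True orbit.step by metis
  next
    case False
    then have "p z = q z" using po that x by auto
    then show ?thesis using that by (metis orbit.intros)
  qed
  have 1: "z \<in> orbit p y" if "z \<in> orbit q y" for z
    using that by induction (use step y sub in blast)+
  have yo: "y \<in> orbit q y" using permutes_self_in_orbit[OF q S] .
  have 2: "x \<in> orbit p y" if "b \<in> orbit q y"
    using 1[OF that] pb orbit.step by metis
  show ?thesis
  proof (cases "b \<in> orbit q y")
    case True
    have "orbit p y \<subseteq> insert x (orbit q y)"
    proof (rule orbit_closed_subset)
      have *: "p z \<in> insert x (orbit q y)" if "z \<in> insert x (orbit q y)" for z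
        using that True pb px po by (metis insert_iff orbit.step)
      then show "p y \<in> insert x (orbit q y)" using yo by blast
      show "\<And>z. z \<in> insert x (orbit q y) \<Longrightarrow> p z \<in> insert x (orbit q y)" by (rule *)
    qed
    then show ?thesis using True 1 2 by auto
  next
    case False
    have "orbit p y \<subseteq> orbit q y"
    proof (rule orbit_closed_subset)
      have *: "p z \<in> orbit q y" if "z \<in> orbit q y" for z
        using that False po sub x by (metis orbit.step subsetD)
      then show "p y \<in> orbit q y" using yo by blast
      show "\<And>z. z \<in> orbit q y \<Longrightarrow> p z \<in> orbit q y" by (rule *)
    qed
    then show ?thesis using False 1 by auto
  qed
qed

lemma insert_point_permutes:
  assumes "q permutes S" "b \<in> S"
  shows "q \<circ> transpose b x permutes insert x S"
  using assms by (intro permutes_compose permutes_swap_id permutes_subset[OF assms(1)]) auto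

text \<open>Since \<open>p b = x\<close>, the new point joins the orbit of \<open>b\<close> and
  creates no orbit of its own.\<close>

lemma orbits_insert_point:
  fixes q :: "'a \<Rightarrow> 'a"
  assumes q: "q permutes S" and S: "finite S" and x: "x \<notin> S" and b: "b \<in> S"
  defines "p \<equiv> q \<circ> transpose b x"
  shows "orbit p ` insert x S = (\<lambda>C. if b \<in> C then insert x C else C) ` orbit q ` S"
proof -
  have p: "p permutes insert x S" unfolding p_def using insert_point_permutes[OF q b] .
  have qx: "q x = x" using q x by (simp add: permutes_not_in)
  have "p b = x" using qx by (simp add: p_def)
  then have "x \<in> orbit p b" by (metis orbit.base)
  then have "orbit p x = orbit p b" using orbit_eq_of_mem[OF p] S by simp
  then have "orbit p ` insert x S = orbit p ` S" using b by auto
  also have "\<dots> = (\<lambda>y. if b \<in> orbit q y then insert x (orbit q y) else orbit q y) ` S"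
    using orbit_insert_point[OF q S x b] by (intro image_cong) (auto simp: p_def)
  finally show ?thesis by (simp add: image_image del: if_image_distrib)
qed

lemma inj_on_insert_point:
  assumes "\<And>C. C \<in> F \<Longrightarrow> x \<notin> C"
  shows "inj_on (\<lambda>C. if b \<in> C then insert x C else C) F"
proof (rule inj_on_inverseI)
  fix C assume "C \<in> F"
  then show "(if b \<in> C then insert x C else C) - {x} = C" using assms by auto
qed

text \<open>The point \<open>b\<close> is recovered as the preimage of \<open>x\<close>, and
  composing with the same transposition again cuts \<open>x\<close> out of its cycle.\<close>

lemma bij_betw_insert_point:
  assumes S: "finite S" and x: "x \<notin> S"
  shows "bij_betw (\<lambda>(b, q). q \<circ> transpose b x) (S \<times> {q. q permutes S})
           {p. p permutes insert x S \<and> p x \<noteq> x}"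
proof (rule bij_betw_byWitness[where f' = "\<lambda>p. (inv p x, p \<circ> transpose (inv p x) x)"])
  show "\<forall>a\<in>S \<times> {q. q permutes S}.
      (\<lambda>p. (inv p x, p \<circ> transpose (inv p x) x)) ((\<lambda>(b, q). q \<circ> transpose b x) a) = a"
  proof
    fix a assume "a \<in> S \<times> {q. q permutes S}"
    then obtain b q where a: "a = (b, q)" and b: "b \<in> S" and q: "q permutes S" by auto
    have qx: "q x = x" using q x by (simp add: permutes_not_in)
    have "(q \<circ> transpose b x) permutes insert x S" using insert_point_permutes[OF q b] .
    then have "inv (q \<circ> transpose b x) x = b"
      using qx by (simp add: permutes_inv_eq)
    then show "(\<lambda>p. (inv p x, p \<circ> transpose (inv p x) x)) ((\<lambda>(b, q). q \<circ> transpose b x) a) = a"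
      by (simp add: a comp_assoc)
  qed
  show "\<forall>p\<in>{p. p permutes insert x S \<and> p x \<noteq> x}.
      (\<lambda>(b, q). q \<circ> transpose b x) (inv p x, p \<circ> transpose (inv p x) x) = p"
    by (auto simp: comp_assoc)
  show "(\<lambda>(b, q). q \<circ> transpose b x) ` (S \<times> {q. q permutes S})
      \<subseteq> {p. p permutes insert x S \<and> p x \<noteq> x}"
  proof clarify
    fix b q assume b: "b \<in> S" and q: "q permutes S"
    have "q b \<in> S" using b q by (simp add: permutes_in_image)
    then show "q \<circ> transpose b x permutes insert x S \<and> (q \<circ> transpose b x) x \<noteq> x"
      using insert_point_permutes[OF q b] x by auto
  qed
  show "(\<lambda>p. (inv p x, p \<circ> transpose (inv p x) x)) ` {p. p permutes insert x S \<and> p x \<noteq> x}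
      \<subseteq> S \<times> {q. q permutes S}"
  proof (rule image_subsetI)
    fix p assume "p \<in> {p. p permutes insert x S \<and> p x \<noteq> x}"
    then have p: "p permutes insert x S" and px: "p x \<noteq> x" by auto
    have pi: "p (inv p x) = x" using p by (simp add: permutes_inverses)
    have "inv p x \<in> insert x S" using permutes_in_image[OF permutes_inv[OF p], of x] by blast
    moreover have "inv p x \<noteq> x" using pi px by metis
    ultimately have i: "inv p x \<in> S" by blast
    have "p \<circ> transpose (inv p x) x permutes insert x S"
      using p i by (intro permutes_compose permutes_swap_id) auto
    \<comment> \<open>The composite maps \<open>x\<close> to \<open>p (inv p x) = x\<close>, so it
      moves points of \<open>S\<close> only.\<close>
    then have "p \<circ> transpose (inv p x) x permutes S"
      by (rule permutes_superset) (use pi in auto)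
    then show "(inv p x, p \<circ> transpose (inv p x) x) \<in> S \<times> {q. q permutes S}" using i by blast
  qed
qed

text \<open>The bijection is restricted to permutations singled out by a condition
  \<open>\<Psi>\<close> on their set of orbits, so that one transfer serves both deletions of the
  recursion.\<close>

lemma card_perms_insert_point:
  assumes S: "finite S" and x: "x \<notin> S"
  shows "card {p. p permutes insert x S \<and> p x \<noteq> x \<and> \<Psi> (orbit p ` insert x S)} =
    (\<Sum>b\<in>S. card {q. q permutes S \<and> \<Psi> ((\<lambda>C. if b \<in> C then insert x C else C) ` orbit q ` S)})"
proof -
  let ?A = "\<lambda>b. {q. q permutes S \<and> \<Psi> ((\<lambda>C. if b \<in> C then insert x C else C) ` orbit q ` S)}"
  note bij = bij_betw_insert_point[OF S x]
  have "bij_betw (\<lambda>(b, q). q \<circ> transpose b x) (SIGMA b:S. ?A b)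
      {p. p permutes insert x S \<and> p x \<noteq> x \<and> \<Psi> (orbit p ` insert x S)}"
  proof (rule bij_betw_imageI)
    show "inj_on (\<lambda>(b, q). q \<circ> transpose b x) (SIGMA b:S. ?A b)"
      by (rule inj_on_subset[OF bij_betw_imp_inj_on[OF bij] Sigma_mono])
        (simp_all add: Collect_mono)
    show "(\<lambda>(b, q). q \<circ> transpose b x) ` (SIGMA b:S. ?A b) =
        {p. p permutes insert x S \<and> p x \<noteq> x \<and> \<Psi> (orbit p ` insert x S)}" (is "?L = ?R")
    proof
      show "?L \<subseteq> ?R"
      proof
        fix p assume "p \<in> ?L"
        then obtain b q where bq: "b \<in> S" "q \<in> ?A b" "p = q \<circ> transpose b x"
          by (auto simp del: if_image_distrib)
        have "(\<lambda>(b, q). q \<circ> transpose b x) (b, q) \<in> {p. p permutes insert x S \<and> p x \<noteq> x}"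
          by (rule bij_betw_apply[OF bij]) (use bq in simp)
        moreover have "\<Psi> (orbit p ` insert x S)"
          using orbits_insert_point[OF _ S x bq(1), of q] bq by (simp del: if_image_distrib image_insert)
        ultimately show "p \<in> ?R" using bq(3) by simp
      qed
      show "?R \<subseteq> ?L"
      proof
        fix p assume p: "p \<in> ?R"
        then have "p \<in> (\<lambda>(b, q). q \<circ> transpose b x) ` (S \<times> {q. q permutes S})"
          unfolding bij_betw_imp_surj_on[OF bij] by simp
        then obtain b q where bq: "b \<in> S" "q permutes S" "p = q \<circ> transpose b x" by auto
        then show "p \<in> ?L"
          using p orbits_insert_point[OF bq(2) S x bq(1)]
          by (intro image_eqI[of _ _ "(b, q)"]) (simp_all del: if_image_distrib image_insert)
      qed
    qed
  qed
  then have "card {p. p permutes insert x S \<and> p x \<noteq> x \<and> \<Psi> (orbit p ` insert x S)}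
      = card (SIGMA b:S. ?A b)" by (simp add: bij_betw_same_card)
  also have "\<dots> = (\<Sum>b\<in>S. card (?A b))"
  proof (rule card_SigmaI[OF S])
    show "\<forall>b\<in>S. finite (?A b)"
      by (intro ballI finite_subset[OF _ finite_permutations[OF S]]) blast
  qed
  finally show ?thesis .
qed

lemma orbit_image_finite_notin:
  assumes q: "q permutes S" and S: "finite S" and x: "x \<notin> S" and C: "C \<in> orbit q ` S"
  shows "finite C" "x \<notin> C"
proof -
  have "C \<subseteq> S" using C permutes_orbit_subset[OF q] by auto
  then show "finite C" "x \<notin> C" using S x finite_subset by auto
qed

lemma card_image_insert_point:
  assumes q: "q permutes S" and S: "finite S" and x: "x \<notin> S"
  shows "card ((\<lambda>C. if b \<in> C then insert x C else C) ` orbit q ` S) = card (orbit q ` S)"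
  by (intro card_image inj_on_insert_point orbit_image_finite_notin(2)[OF q S x])

section \<open>Recursion by deletion of two points\<close>

text \<open>Insertion of \<open>x\<close> after \<open>b\<close> lengthens the cycle of
  \<open>b\<close> by one and no other, so exactly this cycle has to be even before.\<close>

lemma card_odd_cycle_perms_moved:
  assumes S: "finite S" and x: "x \<notin> S"
  shows "card {p \<in> odd_cycle_perms (insert x S) k. p x \<noteq> x} = (\<Sum>b\<in>S. card (even_cycle_perms S k b))"
proof -
  let ?\<Psi> = "\<lambda>F. card F = k \<and> (\<forall>C\<in>F. odd (card C))"
  have "card {p \<in> odd_cycle_perms (insert x S) k. p x \<noteq> x}
     = card {p. p permutes insert x S \<and> p x \<noteq> x \<and> ?\<Psi> (orbit p ` insert x S)}"
    unfolding odd_cycle_perms_def by (rule arg_cong[where f = card]) blast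
  also have "\<dots> =
    (\<Sum>b\<in>S. card {q. q permutes S \<and> ?\<Psi> ((\<lambda>C. if b \<in> C then insert x C else C) ` orbit q ` S)})"
    using card_perms_insert_point[OF S x, of ?\<Psi>] .
  also have "\<dots> = (\<Sum>b\<in>S. card (even_cycle_perms S k b))"
  proof (rule sum.cong[OF refl], rule arg_cong[where f = card])
    fix b
    show "{q. q permutes S \<and> ?\<Psi> ((\<lambda>C. if b \<in> C then insert x C else C) ` orbit q ` S)}
        = even_cycle_perms S k b"
    proof (unfold even_cycle_perms_def, intro Collect_cong conj_cong refl)
      fix q assume q: "q permutes S"
      show "(card ((\<lambda>C. if b \<in> C then insert x C else C) ` orbit q ` S) = k)
          = (card (orbit q ` S) = k)" using card_image_insert_point[OF q S x] by simp
      have *: "odd (card (if b \<in> C then insert x C else C)) \<longleftrightarrow> (odd (card C) \<longleftrightarrow> b \<notin> C)"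
        if "C \<in> orbit q ` S" for C using orbit_image_finite_notin[OF q S x that] by auto
      then show "(\<forall>C\<in>(\<lambda>C. if b \<in> C then insert x C else C) ` orbit q ` S. odd (card C))
          = (\<forall>C\<in>orbit q ` S. odd (card C) = (b \<notin> C))" unfolding ball_simps using * by blast
    qed
  qed
  finally show ?thesis .
qed

text \<open>A point on an even cycle is not fixed, and deleting it makes all cycles odd. Its
  predecessor \<open>b\<close> is arbitrary, so all summands are equal.\<close>

lemma card_even_cycle_perms:
  assumes S: "finite S" and x: "x \<notin> S"
  shows "card (even_cycle_perms (insert x S) k x) = (\<Sum>b\<in>S. card (odd_cycle_perms S k))"
proof -
  let ?\<Psi> = "\<lambda>F. card F = k \<and> (\<forall>C\<in>F. odd (card C) \<longleftrightarrow> x \<notin> C)"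
  have "p x \<noteq> x" if "p \<in> even_cycle_perms (insert x S) k x" for p
  proof
    assume "p x = x"
    then have "orbit p x = {x}" using orbit_eq_singleton_iff by metis
    then show False using that by (auto simp: even_cycle_perms_def)
  qed
  then have "card (even_cycle_perms (insert x S) k x)
     = card {p. p permutes insert x S \<and> p x \<noteq> x \<and> ?\<Psi> (orbit p ` insert x S)}"
    unfolding even_cycle_perms_def by (intro arg_cong[where f = card]) blast
  also have "\<dots> =
    (\<Sum>b\<in>S. card {q. q permutes S \<and> ?\<Psi> ((\<lambda>C. if b \<in> C then insert x C else C) ` orbit q ` S)})"
    using card_perms_insert_point[OF S x, of ?\<Psi>] .
  also have "\<dots> = (\<Sum>b\<in>S. card (odd_cycle_perms S k))"
  proof (rule sum.cong[OF refl], rule arg_cong[where f = card])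
    fix b
    show "{q. q permutes S \<and> ?\<Psi> ((\<lambda>C. if b \<in> C then insert x C else C) ` orbit q ` S)}
        = odd_cycle_perms S k"
    proof (unfold odd_cycle_perms_def, intro Collect_cong conj_cong refl)
      fix q assume q: "q permutes S"
      show "(card ((\<lambda>C. if b \<in> C then insert x C else C) ` orbit q ` S) = k)
          = (card (orbit q ` S) = k)" using card_image_insert_point[OF q S x] by simp
      have *: "(odd (card (if b \<in> C then insert x C else C))
            \<longleftrightarrow> x \<notin> (if b \<in> C then insert x C else C)) \<longleftrightarrow> odd (card C)"
        if "C \<in> orbit q ` S" for C using orbit_image_finite_notin[OF q S x that] by auto
      then show "(\<forall>C\<in>(\<lambda>C. if b \<in> C then insert x C else C) ` orbit q ` S. odd (card C) = (x \<notin> C))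
          = (\<forall>C\<in>orbit q ` S. odd (card C))" unfolding ball_simps using * by blast
    qed
  qed
  finally show ?thesis .
qed

lemma odd_cycle_perms_fixed:
  assumes S: "finite S" and x: "x \<notin> S"
  shows "{p \<in> odd_cycle_perms (insert x S) k. p x = x} =
    (if k = 0 then {} else odd_cycle_perms S (k - 1))"
proof -
  have eq: "p \<in> odd_cycle_perms (insert x S) k \<longleftrightarrow> k \<noteq> 0 \<and> p \<in> odd_cycle_perms S (k - 1)"
    if p: "p permutes S" for p
  proof -
    have px: "p x = x" using p x by (simp add: permutes_not_in)
    have p': "p permutes insert x S" using p by (rule permutes_subset) auto
    have o: "orbit p x = {x}" using px orbit_eq_singleton_iff by metis
    have "{x} \<notin> orbit p ` S" using permutes_orbit_subset[OF p] x by blast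
    then have "card (orbit p ` insert x S) = Suc (card (orbit p ` S))"
      using S by (simp add: o)
    then show ?thesis using p p' by (auto simp: odd_cycle_perms_def o)
  qed
  have "p permutes S" if "p \<in> odd_cycle_perms (insert x S) k" "p x = x" for p
    using permutes_superset[of p "insert x S" S] that by (auto simp: odd_cycle_perms_def)
  moreover have "p permutes S" "p x = x" if "p \<in> odd_cycle_perms S (k - 1)" for p
    using that x by (auto simp: odd_cycle_perms_def permutes_not_in)
  ultimately have "p \<in> {p \<in> odd_cycle_perms (insert x S) k. p x = x} \<longleftrightarrow>
      p \<in> (if k = 0 then {} else odd_cycle_perms S (k - 1))" for p
    using eq by auto
  then show ?thesis by blast
qed

text \<open>The last term removes a non-fixed point together with its preimage, which keeps every
  cycle length odd.\<close>

fun odd_cycle_number :: "nat \<Rightarrow> nat \<Rightarrow> nat" where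
  "odd_cycle_number 0 k = (if k = 0 then 1 else 0)"
| "odd_cycle_number (Suc 0) k = (if k = 1 then 1 else 0)"
| "odd_cycle_number (Suc (Suc n)) k =
    (if k = 0 then 0 else odd_cycle_number (Suc n) (k - 1)) + Suc n * n * odd_cycle_number n k"

text \<open>The first term belongs to a fixed point \<open>x\<close>. Otherwise delete
  \<open>x\<close> and then its former predecessor \<open>a\<close>, which lies on an even cycle by
  then; \<open>b\<close> is the predecessor of \<open>a\<close> at that moment.\<close>

lemma card_odd_cycle_perms_insert:
  assumes S: "finite S" and x: "x \<notin> S"
  shows "card (odd_cycle_perms (insert x S) k) =
    (if k = 0 then 0 else card (odd_cycle_perms S (k - 1)))
      + (\<Sum>a\<in>S. \<Sum>b\<in>S - {a}. card (odd_cycle_perms (S - {a}) k))"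
proof -
  have fin: "finite (odd_cycle_perms (insert x S) k)"
    using S finite_permutations[of "insert x S"]
    by (auto simp: odd_cycle_perms_def intro: finite_subset[rotated])
  have "card (odd_cycle_perms (insert x S) k)
      = card ({p \<in> odd_cycle_perms (insert x S) k. p x = x} \<union> {p \<in> odd_cycle_perms (insert x S) k. p x \<noteq> x})"
    by (rule arg_cong[where f = card]) auto
  also have "\<dots> = card {p \<in> odd_cycle_perms (insert x S) k. p x = x}
      + card {p \<in> odd_cycle_perms (insert x S) k. p x \<noteq> x}"
    using fin by (intro card_Un_disjoint) auto
  also have "card {p \<in> odd_cycle_perms (insert x S) k. p x \<noteq> x}
      = (\<Sum>a\<in>S. \<Sum>b\<in>S - {a}. card (odd_cycle_perms (S - {a}) k))"
    unfolding card_odd_cycle_perms_moved[OF S x]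
  proof (rule sum.cong[OF refl])
    fix a assume "a \<in> S"
    then have "insert a (S - {a}) = S" by auto
    then show "card (even_cycle_perms S k a) = (\<Sum>b\<in>S - {a}. card (odd_cycle_perms (S - {a}) k))"
      using card_even_cycle_perms[of "S - {a}" a k] S by simp
  qed
  finally show ?thesis unfolding odd_cycle_perms_fixed[OF S x] by auto
qed

lemma card_odd_cycle_perms:
  fixes S :: "'a set"
  assumes "finite S"
  shows "card (odd_cycle_perms S k) = odd_cycle_number (card S) k"
  using assms
proof (induction "card S" k arbitrary: S rule: odd_cycle_number.induct)
  case (1 k)
  then have "S = {}" by simp
  then have "odd_cycle_perms S k = (if k = 0 then {id} else {})"
    by (auto simp: odd_cycle_perms_def)
  then show ?case using \<open>S = {}\<close> by simp
next
  case (2 k)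
  then obtain x where S: "S = {x}" by (metis card_1_singletonE One_nat_def)
  have "odd_cycle_perms ({} :: 'a set) m = (if m = 0 then {id} else {})" for m
    by (auto simp: odd_cycle_perms_def)
  then show ?case using card_odd_cycle_perms_insert[of "{}" x k] S by (cases k) auto
next
  case (3 n k)
  then obtain x T where S: "S = insert x T" "x \<notin> T" and T: "card T = Suc n"
    by (metis card_Suc_eq)
  have finT: "finite T" using S 3 by auto
  have c: "card (T - {a}) = n" if "a \<in> T" for a using that T finT by simp
  have "card (odd_cycle_perms S k) = (if k = 0 then 0 else card (odd_cycle_perms T (k - 1)))
      + (\<Sum>a\<in>T. \<Sum>b\<in>T - {a}. card (odd_cycle_perms (T - {a}) k))"
    using card_odd_cycle_perms_insert[OF finT S(2)] S by simp
  also have "(\<Sum>a\<in>T. \<Sum>b\<in>T - {a}. card (odd_cycle_perms (T - {a}) k))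
      = (\<Sum>a\<in>T. n * odd_cycle_number n k)"
    using 3(2)[of "T - {_}"] c finT by (intro sum.cong) auto
  also have "(if k = 0 then 0 else card (odd_cycle_perms T (k - 1)))
      = (if k = 0 then 0 else odd_cycle_number (Suc n) (k - 1))"
    using 3(1)[of T] T finT by simp
  finally show ?case using T by (simp add: 3(3)[symmetric] algebra_simps)
qed

lemma d_eq: "d n k = odd_cycle_number n k"
proof -
  have "d n k = card (odd_cycle_perms {1..n} k)"
    unfolding d_def odd_cycle_perms_def perms_def perm_cycles_def mem_Collect_eq ..
  then show ?thesis using card_odd_cycle_perms[of "{1..n}" k] by simp
qed

lemma odd_cycle_number_eq_0:
  "n < k \<or> odd (n + k) \<or> (k = 0 \<and> n > 0) \<Longrightarrow> odd_cycle_number n k = 0"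
proof (induction n k rule: odd_cycle_number.induct)
  case (3 n k)
  then show ?case by (cases k; cases "n = 0") auto
qed (auto simp: odd_pos)

section \<open>Row polynomials and their difference equation\<close>

text \<open>The exponential generating function of these polynomials is
  \<open>((1 + x) / (1 - x)) ^ (y / 2)\<close>, because odd cycles contribute
  \<open>x + x^3 / 3 + x^5 / 5 + ...\<close>.\<close>

definition odd_cycle_poly :: "nat \<Rightarrow> 'a::comm_ring_1 \<Rightarrow> 'a" where
  "odd_cycle_poly n y = (\<Sum>k\<le>n. of_nat (odd_cycle_number n k) * y ^ k)"

lemma odd_cycle_poly_0: "odd_cycle_poly 0 y = 1"
  and odd_cycle_poly_1: "odd_cycle_poly (Suc 0) y = y"
  by (simp_all add: odd_cycle_poly_def)

lemma odd_cycle_poly_Suc_Suc: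
  "odd_cycle_poly (Suc (Suc n)) y =
     y * odd_cycle_poly (Suc n) y + of_nat (Suc n * n) * odd_cycle_poly n y"
proof -
  have "odd_cycle_poly (Suc (Suc n)) y =
     (\<Sum>k\<le>Suc (Suc n). of_nat (if k = 0 then 0 else odd_cycle_number (Suc n) (k - 1)) * y ^ k)
     + (\<Sum>k\<le>Suc (Suc n). of_nat (Suc n * n) * (of_nat (odd_cycle_number n k) * y ^ k))"
    unfolding odd_cycle_poly_def
    by (simp add: sum.distrib[symmetric] algebra_simps del: sum.atMost_Suc)
  also have "(\<Sum>k\<le>Suc (Suc n). of_nat (if k = 0 then 0 else odd_cycle_number (Suc n) (k - 1)) * y ^ k)
      = y * odd_cycle_poly (Suc n) y"
    unfolding odd_cycle_poly_def sum.atMost_Suc_shift[of _ "Suc n"]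
    by (simp add: sum_distrib_left algebra_simps del: sum.atMost_Suc)
  \<comment> \<open>The two additional terms vanish: \<open>n\<close> points have at most
    \<open>n\<close> cycles.\<close>
  also have "(\<Sum>k\<le>Suc (Suc n). of_nat (Suc n * n) * (of_nat (odd_cycle_number n k) * y ^ k))
      = of_nat (Suc n * n) * odd_cycle_poly n y"
    unfolding odd_cycle_poly_def sum_distrib_left
    by (rule sum.mono_neutral_right) (auto simp: odd_cycle_number_eq_0)
  finally show ?thesis .
qed

text \<open>Raising \<open>y\<close> by 2 multiplies the exponential generating function by
  \<open>(1 + x) / (1 - x)\<close>. Here the coefficient form of this fact is derived from the
  recursion by strong induction.\<close>

lemma odd_cycle_poly_diff:
  "odd_cycle_poly (Suc n) (y + 2) - odd_cycle_poly (Suc n) y =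
     of_nat (Suc n) * (odd_cycle_poly n (y + 2) + odd_cycle_poly n y)"
proof (induction n rule: less_induct)
  case (less n)
  consider "n = 0" | "n = 1" | m where "n = Suc (Suc m)" by (metis One_nat_def not0_implies_Suc)
  then show ?case
  proof cases
    case 3
    define z where "z = y + 2"
    define e where "e = (\<lambda>j. odd_cycle_poly j y)"
    define e' where "e' = (\<lambda>j. odd_cycle_poly j z)"
    define N :: 'a where "N = of_nat m"
    have r: "e (Suc (Suc j)) = y * e (Suc j) + of_nat (Suc j * j) * e j"
            "e' (Suc (Suc j)) = z * e' (Suc j) + of_nat (Suc j * j) * e' j" for j
      unfolding e_def e'_def by (rule odd_cycle_poly_Suc_Suc)+
    have A: "e' (Suc n) = z * e' n + (N + 2) * (N + 1) * e' (Suc m)"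
            "e (Suc n) = y * e n + (N + 2) * (N + 1) * e (Suc m)"
      using r[of "Suc m"] by (simp_all add: 3 N_def algebra_simps)
    have B: "e' n = z * e' (Suc m) + (N + 1) * N * e' m"
            "e n = y * e (Suc m) + (N + 1) * N * e m"
      using r[of m] by (simp_all add: 3 N_def algebra_simps)
    have C: "e' n - e n = (N + 2) * (e' (Suc m) + e (Suc m))"
      using less[of "Suc m"] by (simp add: 3 N_def e_def e'_def z_def algebra_simps)
    have D: "e' (Suc m) - e (Suc m) = (N + 1) * (e' m + e m)"
      using less[of m] by (simp add: 3 N_def e_def e'_def z_def algebra_simps)
    \<comment> \<open>Writing \<open>z = (y + 1) + 1\<close> and \<open>y = (y + 1) - 1\<close>
      leaves a multiple of the sum and one difference, which \<open>D\<close> turns into a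
      sum.\<close>
    have F: "e' n + e n = (y + 1) * (e' (Suc m) + e (Suc m)) + (N + 1) * (N + 1) * (e' m + e m)"
    proof -
      have "e' n + e n = (y + 1) * (e' (Suc m) + e (Suc m)) + (e' (Suc m) - e (Suc m))
          + (N + 1) * N * (e' m + e m)"
        unfolding B z_def by (simp add: algebra_simps)
      then show ?thesis unfolding D by (simp add: algebra_simps)
    qed
    \<comment> \<open>The same splitting around \<open>y + 1\<close>; once \<open>C\<close> and
      \<open>D\<close> are inserted, the right side of \<open>F\<close> appears with factor
      \<open>N + 2\<close>.\<close>
    have "e' (Suc n) - e (Suc n) = (y + 1) * (e' n - e n) + (e' n + e n)
        + (N + 2) * (N + 1) * (e' (Suc m) - e (Suc m))"
      unfolding A z_def by (simp add: algebra_simps)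
    also have "\<dots> = (N + 2) * ((y + 1) * (e' (Suc m) + e (Suc m)) + (N + 1) * (N + 1) * (e' m + e m))
        + (e' n + e n)"
      unfolding C D by (simp add: algebra_simps)
    also have "\<dots> = (N + 3) * (e' n + e n)"
      unfolding F[symmetric] by (simp add: algebra_simps)
    finally have "e' (Suc n) - e (Suc n) = (N + 3) * (e' n + e n)" .
    then show ?thesis by (simp add: 3 N_def e_def e'_def z_def algebra_simps)
  next
    case 2
    then show ?thesis
      using odd_cycle_poly_Suc_Suc[of 0 y] odd_cycle_poly_Suc_Suc[of 0 "y + 2"]
      by (simp add: odd_cycle_poly_1 algebra_simps)
  qed (simp add: odd_cycle_poly_0 odd_cycle_poly_1)
qed

section \<open>Enriched order polynomials\<close>

text \<open>The letters \<open>2 j\<close> and \<open>2 j - 1\<close> stand for \<open>j\<close> and \<open>-j\<close> in the alphabet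
  \<open>0 < -1 < 1 < -2 < 2 < \<dots>\<close> of enriched \<open>P\<close>-partitions.\<close>

definition super_words :: "nat \<Rightarrow> nat \<Rightarrow> nat \<Rightarrow> (nat \<Rightarrow> bool) \<Rightarrow> (nat \<Rightarrow> nat) set" where
  "super_words lo hi n D = {f \<in> {1..n} \<rightarrow>\<^sub>E {lo..hi}.
     \<forall>i\<in>{1..<n}. f i < f (Suc i) \<or> f i = f (Suc i) \<and> (D i \<longleftrightarrow> odd (f i))}"

text \<open>The number of words of length \<open>n + 1\<close> with last letter \<open>c\<close>.\<close>

fun super_word_count :: "nat \<Rightarrow> (nat \<Rightarrow> bool) \<Rightarrow> nat \<Rightarrow> nat \<Rightarrow> nat" where
  "super_word_count lo D 0 c = (if lo \<le> c then 1 else 0)"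
| "super_word_count lo D (Suc n) c =
     (\<Sum>b<c. super_word_count lo D n b) + (if D (Suc n) \<longleftrightarrow> odd c then super_word_count lo D n c else 0)"

lemma finite_super_words: "finite (super_words lo hi n D)"
  unfolding super_words_def by (rule finite_subset[of _ "{1..n} \<rightarrow>\<^sub>E {lo..hi}"]) (auto intro: finite_PiE)

text \<open>This permits a choice of \<open>D 0\<close>, on which the convention in
  \<open>peak_count\<close> rests.\<close>

lemma super_words_cong:
  assumes "\<And>i. i \<in> {1..<n} \<Longrightarrow> D i = D' i"
  shows "super_words lo hi n D = super_words lo hi n D'"
  unfolding super_words_def using assms by auto

text \<open>Deleting the last letter gives the recursion. Letters weakly increase, so the last one
  bounds all others and \<open>super_word_count\<close> can do with the lower bound alone.\<close>

lemma card_super_words_last: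
  assumes "c \<le> hi"
  shows "card {f \<in> super_words lo hi (Suc n) D. f (Suc n) = c} = super_word_count lo D n c"
  using assms
proof (induction n arbitrary: c)
  case 0
  have "{f \<in> super_words lo hi (Suc 0) D. f (Suc 0) = c}
      = (if lo \<le> c then {\<lambda>i. if i = Suc 0 then c else undefined} else {})"
    using 0 by (auto simp: super_words_def PiE_def extensional_def fun_eq_iff)
  then show ?case by simp
next
  case (Suc n)
  define ok where "ok b \<longleftrightarrow> b < c \<or> b = c \<and> (D (Suc n) \<longleftrightarrow> odd b)" for b
  let ?B = "{b. ok b}"
  have fin: "finite ?B" by (rule finite_subset[of _ "{..c}"]) (auto simp: ok_def)
  have "card {f \<in> super_words lo hi (Suc (Suc n)) D. f (Suc (Suc n)) = c}
      = card {f \<in> super_words lo hi (Suc n) D. ok (f (Suc n))}"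
  proof (rule bij_betw_same_card[of "\<lambda>f. restrict f {1..Suc n}"],
         rule bij_betw_byWitness[where f' = "\<lambda>f. f(Suc (Suc n) := c)"])
    show "\<forall>f\<in>{f \<in> super_words lo hi (Suc (Suc n)) D. f (Suc (Suc n)) = c}.
        (restrict f {1..Suc n})(Suc (Suc n) := c) = f"
      by (auto simp: super_words_def fun_eq_iff PiE_def extensional_def)
    show "\<forall>f\<in>{f \<in> super_words lo hi (Suc n) D. ok (f (Suc n))}.
        restrict (f(Suc (Suc n) := c)) {1..Suc n} = f"
      by (auto simp: super_words_def fun_eq_iff PiE_def extensional_def)
    show "(\<lambda>f. restrict f {1..Suc n}) ` {f \<in> super_words lo hi (Suc (Suc n)) D. f (Suc (Suc n)) = c}
        \<subseteq> {f \<in> super_words lo hi (Suc n) D. ok (f (Suc n))}"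
    proof (rule image_subsetI)
      fix f assume "f \<in> {f \<in> super_words lo hi (Suc (Suc n)) D. f (Suc (Suc n)) = c}"
      then have f: "f \<in> {1..Suc (Suc n)} \<rightarrow>\<^sub>E {lo..hi}" and c: "f (Suc (Suc n)) = c"
        and s: "\<And>i. i \<in> {1..<Suc (Suc n)} \<Longrightarrow>
          f i < f (Suc i) \<or> f i = f (Suc i) \<and> (D i \<longleftrightarrow> odd (f i))"
        by (auto simp: super_words_def)
      have "ok (f (Suc n))" using s[of "Suc n"] c by (auto simp: ok_def)
      moreover have "restrict f {1..Suc n} \<in> super_words lo hi (Suc n) D"
        using f s by (auto simp: super_words_def PiE_iff)
      ultimately show "restrict f {1..Suc n} \<in> {f \<in> super_words lo hi (Suc n) D. ok (f (Suc n))}"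
        by simp
    qed
    show "(\<lambda>f. f(Suc (Suc n) := c)) ` {f \<in> super_words lo hi (Suc n) D. ok (f (Suc n))}
        \<subseteq> {f \<in> super_words lo hi (Suc (Suc n)) D. f (Suc (Suc n)) = c}"
    proof (rule image_subsetI)
      fix f assume "f \<in> {f \<in> super_words lo hi (Suc n) D. ok (f (Suc n))}"
      then have f: "f \<in> {1..Suc n} \<rightarrow>\<^sub>E {lo..hi}" and c: "ok (f (Suc n))"
        and s: "\<And>i. i \<in> {1..<Suc n} \<Longrightarrow>
          f i < f (Suc i) \<or> f i = f (Suc i) \<and> (D i \<longleftrightarrow> odd (f i))"
        by (auto simp: super_words_def)
      have "f (Suc n) \<in> {lo..hi}" using f by (auto simp: PiE_iff)
      \<comment> \<open>For longer words the recursion does not test the lower bound of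
        \<open>c\<close>; it is inherited from the preceding letter.\<close>
      then have "lo \<le> c" using c by (auto simp: ok_def)
      then have "f(Suc (Suc n) := c) \<in> {1..Suc (Suc n)} \<rightarrow>\<^sub>E {lo..hi}"
        using f Suc.prems by (auto simp: PiE_iff extensional_def le_Suc_eq)
      moreover have "(f(Suc (Suc n) := c)) i < (f(Suc (Suc n) := c)) (Suc i) \<or>
          (f(Suc (Suc n) := c)) i = (f(Suc (Suc n) := c)) (Suc i)
            \<and> (D i \<longleftrightarrow> odd ((f(Suc (Suc n) := c)) i))" if "i \<in> {1..<Suc (Suc n)}" for i
        using that s[of i] c by (cases "i = Suc n") (auto simp: ok_def)
      ultimately show "f(Suc (Suc n) := c) \<in> {f \<in> super_words lo hi (Suc (Suc n)) D. f (Suc (Suc n)) = c}"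
        unfolding super_words_def by auto
    qed
  qed
  also have "{f \<in> super_words lo hi (Suc n) D. ok (f (Suc n))}
      = (\<Union>b\<in>?B. {f \<in> super_words lo hi (Suc n) D. f (Suc n) = b})" by auto
  also have "card \<dots> = (\<Sum>b\<in>?B. card {f \<in> super_words lo hi (Suc n) D. f (Suc n) = b})"
    using fin finite_super_words by (intro card_UN_disjoint) auto
  also have "\<dots> = (\<Sum>b\<in>?B. super_word_count lo D n b)"
    using Suc by (intro sum.cong refl Suc.IH) (auto simp: ok_def)
  also have "?B = {..<c} \<union> (if D (Suc n) \<longleftrightarrow> odd c then {c} else {})" by (auto simp: ok_def)
  also have "(\<Sum>b\<in>\<dots>. super_word_count lo D n b) = super_word_count lo D (Suc n) c"
    by (subst sum.union_disjoint) auto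
  finally show ?case .
qed

lemma card_super_words:
  "card (super_words lo hi (Suc n) D) = (\<Sum>c\<le>hi. super_word_count lo D n c)"
proof -
  have "super_words lo hi (Suc n) D = (\<Union>c\<in>{..hi}. {f \<in> super_words lo hi (Suc n) D. f (Suc n) = c})"
    by (auto simp: super_words_def PiE_iff)
  then have "card (super_words lo hi (Suc n) D)
      = card (\<Union>c\<in>{..hi}. {f \<in> super_words lo hi (Suc n) D. f (Suc n) = c})" by simp
  also have "\<dots> = (\<Sum>c\<le>hi. card {f \<in> super_words lo hi (Suc n) D. f (Suc n) = c})"
    using finite_super_words by (intro card_UN_disjoint) auto
  also have "\<dots> = (\<Sum>c\<le>hi. super_word_count lo D n c)"
    by (intro sum.cong) (auto simp: card_super_words_last)
  finally show ?thesis .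
qed

section \<open>Rational generating functions of the words\<close>

definition fps_R :: "'a::field_char_0 fps" where
  "fps_R = (1 + fps_X) * inverse (1 - fps_X)"

definition fps_S :: "'a::field_char_0 fps" where
  "fps_S = 4 * fps_X * inverse (1 + fps_X) ^ 2"

lemma inverse_one_minus_X: "(1 - fps_X) * inverse (1 - fps_X :: 'a::field_char_0 fps) = 1"
  by (rule inverse_mult_eq_1') simp

lemma inverse_one_plus_X: "(1 + fps_X) * inverse (1 + fps_X :: 'a::field_char_0 fps) = 1"
  by (rule inverse_mult_eq_1') simp

lemma inverse_one_minus_X_eq: "inverse (1 - fps_X :: 'a::field_char_0 fps) = Abs_fps (\<lambda>_. 1)"
  using fps_inverse_idempotent[of "Abs_fps (\<lambda>_. 1 :: 'a)"] by (simp add: fps_inverse_gp')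

text \<open>The defining relation of the constant one half, supplied to the ring computations in
  which this constant is an atom.\<close>

lemma fps_half: "2 * fps_const (1 / 2 :: 'a::field_char_0) = 1"
  by (simp add: numeral_fps_const)

lemma fps_S_nth_0: "fps_S $ 0 = 0"
  by (simp add: fps_S_def)

lemma fps_S_neq_0: "fps_S \<noteq> (0 :: 'a::field_char_0 fps)"
proof
  assume *: "fps_S = (0 :: 'a fps)"
  have "4 * fps_X = fps_S * (1 + fps_X :: 'a fps) ^ 2"
    using inverse_one_plus_X[where 'a = 'a] unfolding fps_S_def by algebra
  then have "fps_X = (0 :: 'a fps)" using * by simp
  then show False by simp
qed

lemma fps_R_neq_0: "fps_R \<noteq> (0 :: 'a::field_char_0 fps)"
proof
  assume "fps_R = (0 :: 'a fps)"
  then have "fps_R $ 0 = (0 :: 'a)" by simp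
  then show False by (simp add: fps_R_def)
qed

text \<open>This is \<open>(1 + X)^2 - 4 X = (1 - X)^2\<close>. It later trades an even power of
  \<open>fps_R\<close> for a power of \<open>1 - fps_S\<close>.\<close>

lemma fps_R_squared: "fps_R ^ 2 * (1 - fps_S) = (1 :: 'a::field_char_0 fps)"
  using inverse_one_plus_X[where 'a = 'a] inverse_one_minus_X[where 'a = 'a]
  unfolding fps_R_def fps_S_def by algebra

text \<open>The value \<open>D 0\<close> is a convention for what happens before the first position: with
  \<open>\<not> D 0\<close> this counts left peaks, with \<open>D 0\<close> it counts peaks.\<close>

definition peak_count :: "nat \<Rightarrow> (nat \<Rightarrow> bool) \<Rightarrow> nat" where
  "peak_count n D = card {i \<in> {1..<n}. D i \<and> \<not> D (i - 1)}"

lemma peak_count_Suc_Suc: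
  "peak_count (Suc (Suc n)) D = peak_count (Suc n) D + (if D (Suc n) \<and> \<not> D n then 1 else 0)"
proof -
  have "{i \<in> {1..<Suc (Suc n)}. D i \<and> \<not> D (i - 1)} =
     {i \<in> {1..<Suc n}. D i \<and> \<not> D (i - 1)} \<union> (if D (Suc n) \<and> \<not> D n then {Suc n} else {})"
    by (auto simp: less_Suc_eq)
  then show ?thesis unfolding peak_count_def
    by (simp add: card_Un_disjoint)
qed

text \<open>\<open>P\<close> and \<open>N\<close> are the generating functions of the words with a given last letter, which is
  even for \<open>P\<close> and odd for \<open>N\<close>. They are proportional with a factor that depends on the last
  step only, hence each step multiplies \<open>P\<close> by one of four factors.\<close>

context
  fixes D :: "nat \<Rightarrow> bool" and lo :: nat and P N Q :: "nat \<Rightarrow> 'a::field_char_0 fps"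
    and front :: "'a fps"
  assumes lo: "lo = (if D 0 then 1 else 0)"
  defines "P \<equiv> \<lambda>n. Abs_fps (\<lambda>j. of_nat (super_word_count lo D n (2 * j)))"
    and "N \<equiv> \<lambda>n. Abs_fps (\<lambda>j. if j = 0 then 0 else of_nat (super_word_count lo D n (2 * j - 1)))"
    and "Q \<equiv> \<lambda>n. Abs_fps (\<lambda>k. of_nat (\<Sum>c\<le>2 * k. super_word_count lo D n c))"
    and "front \<equiv> if D 0 then fps_const (1/2) * fps_R * fps_S else inverse (1 - fps_X)"
begin

text \<open>Multiplication by \<open>1 - X\<close> takes differences in \<open>k\<close>, and each
  step admits the last letters \<open>2 k - 1\<close> and \<open>2 k\<close>. The constant term of
  \<open>N\<close> is set to 0 because \<open>2 * 0 - 1\<close> would be the letter 0, which belongs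
  to \<open>P\<close>.\<close>

lemma fps_Q: "(1 - fps_X) * Q n = P n + N n"
proof (rule fps_ext)
  fix k
  show "((1 - fps_X) * Q n) $ k = (P n + N n) $ k"
    by (cases k) (simp_all add: left_diff_distrib Q_def P_def N_def)
qed

text \<open>The letter before \<open>2 k\<close> is any letter up to \<open>2 k\<close>, with
  \<open>2 k\<close> itself excluded at a descent.\<close>

lemma fps_P_Suc: "P (Suc n) = Q n - (if D (Suc n) then P n else 0)"
proof (rule fps_ext)
  fix k :: nat
  have "{..2 * k} = insert (2 * k) {..<2 * k}" by auto
  then show "P (Suc n) $ k = (Q n - (if D (Suc n) then P n else 0)) $ k"
    by (simp add: Q_def P_def)
qed

text \<open>The letter before \<open>2 k - 1\<close> is at most \<open>2 (k - 1)\<close>, whence the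
  shift by \<open>X\<close>, or at a descent also \<open>2 k - 1\<close> itself.\<close>

lemma fps_N_Suc: "N (Suc n) = fps_X * Q n + (if D (Suc n) then N n else 0)"
proof (rule fps_ext)
  fix k
  show "N (Suc n) $ k = (fps_X * Q n + (if D (Suc n) then N n else 0)) $ k"
  proof (cases k)
    case (Suc j)
    have "{..<Suc (2 * j)} = {..2 * j}" by auto
    then show ?thesis by (simp add: Q_def N_def Suc)
  qed (simp add: N_def)
qed

text \<open>By \<open>fps_Q\<close>, \<open>Q - P = X Q + N\<close>, which settles the case of a
  descent. The choice of \<open>lo\<close> extends the pattern to \<open>n = 0\<close>, as if
  \<open>D 0\<close> were a step before the first position.\<close>

lemma fps_N_eq: "N n = (if D n then P n else fps_X * P n)"
proof (cases n)
  case 0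
  show ?thesis
    by (rule fps_ext) (auto simp: 0 N_def P_def lo)
next
  case (Suc m)
  show ?thesis using fps_Q[of m] by (simp add: Suc fps_P_Suc fps_N_Suc algebra_simps)
qed

text \<open>A factor \<open>(1 + X) / 2\<close> is present exactly while the last step is a descent.
  With this correction every step contributes \<open>fps_R\<close>, and a descent after an ascent
  also contributes \<open>fps_S\<close>.\<close>

lemma fps_P_eq:
  "P n = front * fps_R ^ n * fps_S ^ peak_count (Suc n) D *
     (if D n then fps_const (1/2) * (1 + fps_X) else 1)"
proof (induction n)
  case 0
  have pc: "peak_count (Suc 0) D = 0" by (simp add: peak_count_def)
  show ?case
  proof (cases "D 0")
    case True
    have "P 0 = fps_X * inverse (1 - fps_X)"
      by (rule fps_ext) (simp add: P_def lo True inverse_one_minus_X_eq)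
    \<comment> \<open>This value dictates \<open>front\<close> when \<open>D 0\<close> holds: the
      virtual first descent already carries the factor \<open>(1 + X) / 2\<close>.\<close>
    also have "\<dots> = fps_const (1/2) * fps_R * fps_S * (fps_const (1/2) * (1 + fps_X))"
      using inverse_one_plus_X[where 'a = 'a] fps_half[where 'a = 'a]
      unfolding fps_R_def fps_S_def by algebra
    finally show ?thesis using True pc by (simp add: front_def)
  next
    case False
    have "P 0 = inverse (1 - fps_X)"
      by (simp add: P_def lo False inverse_one_minus_X_eq)
    then show ?thesis using False pc by (simp add: front_def)
  qed
next
  case (Suc n)
  let ?I = "inverse (1 - fps_X :: 'a fps)"
  let ?h = "fps_const (1/2 :: 'a)"
  \<comment> \<open>The first part is the ratio of \<open>P n + N n\<close> to \<open>P n\<close>;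
    the second forbids repeating the even letter at a descent.\<close>
  let ?w = "(if D n then 2 else 1 + fps_X) - (if D (Suc n) then 1 - fps_X else 0) :: 'a fps"
  have "(1 - fps_X) * P (Suc n) = P n + N n - (if D (Suc n) then (1 - fps_X) * P n else 0)"
    unfolding fps_P_Suc fps_Q[symmetric] by (simp add: right_diff_distrib)
  also have "\<dots> = P n * ?w"
    by (cases "D n"; cases "D (Suc n)") (simp_all add: fps_N_eq algebra_simps)
  finally have P: "P (Suc n) = P n * ?w * ?I"
    using inverse_one_minus_X[where 'a = 'a] by algebra
  have down: "fps_R * fps_S * (?h * (1 + fps_X)) = 2 * fps_X * ?I"
    using inverse_one_plus_X[where 'a = 'a] fps_half[where 'a = 'a]
    unfolding fps_R_def fps_S_def by algebra
  have up: "(?h * (1 + fps_X)) * 2 * ?I = fps_R"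
    using fps_half[where 'a = 'a] unfolding fps_R_def by algebra
  define G where "G = front * fps_R ^ n * fps_S ^ peak_count (Suc n) D"
  have IH: "P n = G * (if D n then ?h * (1 + fps_X) else 1)" using Suc unfolding G_def .
  consider "D n" "D (Suc n)" | "D n" "\<not> D (Suc n)" | "\<not> D n" "D (Suc n)" | "\<not> D n" "\<not> D (Suc n)"
    by blast
  then show ?case
  proof cases
    case 1
    have "P (Suc n) = G * fps_R * (?h * (1 + fps_X))"
      unfolding P IH fps_R_def using 1 by (simp add: algebra_simps)
    then show ?thesis using 1 by (simp add: G_def peak_count_Suc_Suc algebra_simps)
  next
    case 2
    have "P (Suc n) = G * ((?h * (1 + fps_X)) * 2 * ?I)"
      unfolding P IH using 2 by (simp add: algebra_simps)
    then show ?thesis unfolding up using 2 by (simp add: G_def peak_count_Suc_Suc algebra_simps)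
  next
    case 3
    have "P (Suc n) = G * (2 * fps_X * ?I)"
      unfolding P IH using 3 by (simp add: algebra_simps)
    then show ?thesis unfolding down[symmetric] using 3
      by (simp add: G_def peak_count_Suc_Suc algebra_simps)
  next
    case 4
    have "P (Suc n) = G * fps_R"
      unfolding P IH fps_R_def using 4 by (simp add: algebra_simps)
    then show ?thesis using 4 by (simp add: G_def peak_count_Suc_Suc algebra_simps)
  qed
qed

text \<open>Adding \<open>N n\<close> cancels the correction factor: in both cases the sum is
  \<open>1 + X\<close> times the same product.\<close>

lemma fps_Q_eq: "Q n = front * fps_R ^ Suc n * fps_S ^ peak_count (Suc n) D"
proof -
  let ?I = "inverse (1 - fps_X :: 'a fps)"
  have "Q n = (P n + N n) * ?I"
    using fps_Q[of n] inverse_one_minus_X[where 'a = 'a] by algebra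
  also have "P n + N n = front * fps_R ^ n * fps_S ^ peak_count (Suc n) D * (1 + fps_X)"
  proof (cases "D n")
    case True
    have "P n + N n = front * fps_R ^ n * fps_S ^ peak_count (Suc n) D * (1 + fps_X)
        * (2 * fps_const (1/2))"
      using True by (simp add: fps_N_eq fps_P_eq algebra_simps)
    then show ?thesis by (simp only: fps_half) simp
  qed (simp add: fps_N_eq fps_P_eq algebra_simps)
  finally show ?thesis by (simp add: fps_R_def algebra_simps)
qed

lemma fps_super_words:
  assumes "n \<ge> 1"
  shows "Abs_fps (\<lambda>k. of_nat (card (super_words lo (2 * k) n D))) =
    (if D 0 then fps_const (1/2) * fps_R * fps_S else inverse (1 - fps_X))
      * fps_R ^ n * (fps_S ^ peak_count n D :: 'a fps)"
proof -
  obtain m where "n = Suc m" using assms by (cases n) auto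
  then show ?thesis using fps_Q_eq[of m] unfolding Q_def front_def by (simp add: card_super_words)
qed

end

section \<open>Standardization\<close>

definition descent :: "(nat \<Rightarrow> nat) \<Rightarrow> nat \<Rightarrow> bool" where
  "descent \<pi> i \<longleftrightarrow> \<pi> (Suc i) < \<pi> i"

text \<open>These are the descents of the standardization of \<open>w\<close>, in which equal odd
  letters are ranked from right to left.\<close>

definition super_descent :: "(nat \<Rightarrow> nat) \<Rightarrow> nat \<Rightarrow> bool" where
  "super_descent w i \<longleftrightarrow> w (Suc i) < w i \<or> w i = w (Suc i) \<and> odd (w i)"

text \<open>Sorting by this key orders equal even letters from left to right and equal odd letters
  from right to left.\<close>

definition std_key :: "nat \<Rightarrow> (nat \<Rightarrow> nat) \<Rightarrow> nat \<Rightarrow> nat" where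
  "std_key n w i = w i * Suc n + (if even (w i) then i else n - i)"

section \<open>Ranking by an injective key\<close>

text \<open>With \<open>k = std_key n w\<close> this says that \<open>\<sigma>\<close> is the
  standardization of \<open>w\<close>.\<close>

definition order_iso :: "nat \<Rightarrow> (nat \<Rightarrow> nat) \<Rightarrow> (nat \<Rightarrow> nat) \<Rightarrow> bool" where
  "order_iso n k \<sigma> \<longleftrightarrow> (\<forall>i\<in>{1..n}. \<forall>j\<in>{1..n}. \<sigma> i < \<sigma> j \<longleftrightarrow> k i < k j)"

lemma block_less:
  fixes a b u v m :: nat
  assumes "u < m" "a < b"
  shows "a * m + u < b * m + v"
proof -
  have "a * m + u < Suc a * m" using assms by simp
  also have "\<dots> \<le> b * m" using assms by (intro mult_le_mono1) simp
  finally show ?thesis by simp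
qed

text \<open>Two-digit numbers in base \<open>m\<close> compare lexicographically;
  \<open>std_key\<close> and \<open>pair_code\<close> both have this form.\<close>

lemma block_less_iff:
  fixes a b u v m :: nat
  assumes "u < m" "v < m"
  shows "a * m + u < b * m + v \<longleftrightarrow> a < b \<or> a = b \<and> u < v"
  using block_less[OF assms(1), of a b v] block_less[OF assms(2), of b a u]
  by (cases a b rule: linorder_cases) auto

lemma std_key_less_iff:
  assumes "i \<in> {1..n}" "j \<in> {1..n}"
  shows "std_key n w i < std_key n w j \<longleftrightarrow>
    w i < w j \<or> w i = w j \<and> (if even (w i) then i < j else j < i)"
  using assms unfolding std_key_def by (subst block_less_iff) auto

lemma inj_on_std_key: "inj_on (std_key n w) {1..n}"
proof (rule inj_onI)
  fix i j assume ij: "i \<in> {1..n}" "j \<in> {1..n}" "std_key n w i = std_key n w j"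
  then show "i = j" using std_key_less_iff[OF ij(1,2), of w] std_key_less_iff[OF ij(2,1), of w]
    by (auto split: if_splits)
qed

text \<open>A permutation of \<open>{1..n}\<close> is its own rank function, and ranks depend on the
  order only. Hence the key determines \<open>\<sigma>\<close>.\<close>

lemma order_iso_eq_rank:
  assumes \<sigma>: "\<sigma> permutes {1..n}" and iso: "order_iso n k \<sigma>" and i: "i \<in> {1..n}"
  shows "\<sigma> i = card {j \<in> {1..n}. \<not> k i < k j}"
proof -
  have si: "\<sigma> i \<in> {1..n}" using \<sigma> i by (simp only: permutes_in_image)
  have "{j \<in> {1..n}. \<not> k i < k j} = {j \<in> {1..n}. \<sigma> j \<le> \<sigma> i}"
    using iso i by (auto simp: order_iso_def not_less[symmetric])
  moreover have "\<sigma> ` {j \<in> {1..n}. \<sigma> j \<le> \<sigma> i} = {1..\<sigma> i}"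
  proof
    show "\<sigma> ` {j \<in> {1..n}. \<sigma> j \<le> \<sigma> i} \<subseteq> {1..\<sigma> i}"
      using permutes_image[OF \<sigma>] by auto
    show "{1..\<sigma> i} \<subseteq> \<sigma> ` {j \<in> {1..n}. \<sigma> j \<le> \<sigma> i}"
    proof
      fix a assume a: "a \<in> {1..\<sigma> i}"
      then have "a \<in> \<sigma> ` {1..n}" using permutes_image[OF \<sigma>] si by auto
      then show "a \<in> \<sigma> ` {j \<in> {1..n}. \<sigma> j \<le> \<sigma> i}" using a by auto
    qed
  qed
  moreover have "inj_on \<sigma> {j \<in> {1..n}. \<sigma> j \<le> \<sigma> i}" using permutes_inj_on[OF \<sigma>] .
  ultimately show ?thesis by (metis card_image card_atLeastAtMost diff_Suc_1)
qed

lemma order_iso_unique: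
  assumes "\<sigma> permutes {1..n}" "order_iso n k \<sigma>" "\<tau> permutes {1..n}" "order_iso n k \<tau>"
  shows "\<sigma> = \<tau>"
proof
  fix i
  show "\<sigma> i = \<tau> i"
    using assms order_iso_eq_rank[of _ n k i] permutes_not_in[of _ "{1..n}" i]
    by (cases "i \<in> {1..n}") metis+
qed

text \<open>The witness is the rank function of \<open>k\<close>, continued by the identity.\<close>

lemma order_iso_exists:
  assumes inj: "inj_on k {1..n}"
  shows "\<exists>\<sigma>. \<sigma> permutes {1..n} \<and> order_iso n k \<sigma>"
proof -
  define r where "r i = (if i \<in> {1..n} then card {j \<in> {1..n}. k j \<le> k i} else i)" for i
  have r_less: "r i < r j" if "i \<in> {1..n}" "j \<in> {1..n}" "k i < k j" for i j
  proof -
    have "{l \<in> {1..n}. k l \<le> k i} \<subset> {l \<in> {1..n}. k l \<le> k j}"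
    proof (rule psubsetI)
      show "{l \<in> {1..n}. k l \<le> k i} \<subseteq> {l \<in> {1..n}. k l \<le> k j}" using that by auto
      have "j \<in> {l \<in> {1..n}. k l \<le> k j}" "j \<notin> {l \<in> {1..n}. k l \<le> k i}" using that by auto
      then show "{l \<in> {1..n}. k l \<le> k i} \<noteq> {l \<in> {1..n}. k l \<le> k j}" by metis
    qed
    then have "card {l \<in> {1..n}. k l \<le> k i} < card {l \<in> {1..n}. k l \<le> k j}"
      by (rule psubset_card_mono[rotated]) simp
    then show ?thesis using that(1,2) by (simp only: r_def if_True)
  qed
  have iff: "r i < r j \<longleftrightarrow> k i < k j" if "i \<in> {1..n}" "j \<in> {1..n}" for i j
  proof (cases "k i" "k j" rule: linorder_cases)
    case less
    then show ?thesis using r_less[OF that] by simp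
  next
    case equal
    then have "i = j" using inj_onD[OF inj equal that] by simp
    then show ?thesis by simp
  next
    case greater
    then show ?thesis using r_less[OF that(2,1)] by simp
  qed
  have "inj_on r {1..n}"
  proof (rule inj_onI)
    fix i j assume ij: "i \<in> {1..n}" "j \<in> {1..n}" and eq: "r i = r j"
    have "\<not> k i < k j" "\<not> k j < k i" using iff[OF ij] iff[OF ij(2,1)] eq by simp_all
    then have "k i = k j" by linarith
    then show "i = j" using inj_onD[OF inj _ ij] by blast
  qed
  moreover have "r ` {1..n} \<subseteq> {1..n}"
  proof (rule image_subsetI)
    fix i assume i: "i \<in> {1..n}"
    have "card {j \<in> {1..n}. k j \<le> k i} \<le> card {1..n}" by (intro card_mono) auto
    moreover have "card {j \<in> {1..n}. k j \<le> k i} > 0" using i by (auto simp: card_gt_0_iff)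
    ultimately show "r i \<in> {1..n}" using i by (simp add: r_def)
  qed
  ultimately have "bij_betw r {1..n} {1..n}"
    by (simp add: bij_betw_def endo_inj_surj)
  then have "r permutes {1..n}" by (rule bij_imp_permutes) (auto simp: r_def)
  then show ?thesis using iff unfolding order_iso_def by blast
qed

text \<open>The inverse of \<open>\<sigma>\<close> lists the positions by increasing value of
  \<open>\<sigma>\<close>, so comparing neighbours in this list suffices by transitivity.\<close>

lemma increasing_iff_order_iso:
  assumes \<sigma>: "\<sigma> permutes {1..n}"
  shows "(\<forall>a\<in>{1..<n}. k (inv \<sigma> a) < k (inv \<sigma> (Suc a))) \<longleftrightarrow> order_iso n k \<sigma>"
proof
  assume step: "\<forall>a\<in>{1..<n}. k (inv \<sigma> a) < k (inv \<sigma> (Suc a))"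
  have mono: "k (inv \<sigma> a) < k (inv \<sigma> b)" if "a < b" "1 \<le> a" "b \<le> n" for a b
    using that
  proof (induction b)
    case (Suc b)
    have last: "k (inv \<sigma> b) < k (inv \<sigma> (Suc b))" if "1 \<le> b" using step Suc.prems that by auto
    show ?case
    proof (cases "a = b")
      case True
      then show ?thesis using last Suc.prems by simp
    next
      case False
      then show ?thesis using last Suc.IH Suc.prems by simp
    qed
  qed simp
  show "order_iso n k \<sigma>"
    unfolding order_iso_def
  proof (intro ballI)
    fix i j assume ij: "i \<in> {1..n}" "j \<in> {1..n}"
    have s: "\<sigma> i \<in> {1..n}" "\<sigma> j \<in> {1..n}" using ij permutes_in_image[OF \<sigma>] by blast+
    have inv: "inv \<sigma> (\<sigma> l) = l" for l using permutes_inverses(2)[OF \<sigma>] .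
    show "\<sigma> i < \<sigma> j \<longleftrightarrow> k i < k j"
    proof (cases "\<sigma> i" "\<sigma> j" rule: linorder_cases)
      case less
      then show ?thesis using mono[OF less] s inv by simp
    next
      case equal
      then have "i = j" using inv by metis
      then show ?thesis by simp
    next
      case greater
      then show ?thesis using mono[OF greater] s inv by simp
    qed
  qed
next
  assume iso: "order_iso n k \<sigma>"
  show "\<forall>a\<in>{1..<n}. k (inv \<sigma> a) < k (inv \<sigma> (Suc a))"
  proof
    fix a assume a: "a \<in> {1..<n}"
    have "inv \<sigma> a \<in> {1..n}" "inv \<sigma> (Suc a) \<in> {1..n}"
      using a permutes_in_image[OF permutes_inv[OF \<sigma>]] by auto
    then have "\<sigma> (inv \<sigma> a) < \<sigma> (inv \<sigma> (Suc a)) \<longleftrightarrow> k (inv \<sigma> a) < k (inv \<sigma> (Suc a))"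
      using iso unfolding order_iso_def by blast
    then show "k (inv \<sigma> a) < k (inv \<sigma> (Suc a))"
      by (simp add: permutes_inverses(1)[OF \<sigma>])
  qed
qed

section \<open>Sums over standardizations\<close>

text \<open>For neighbours in the rearranged word the condition in \<open>super_words\<close> is an
  increase of the key: equal even letters must come from increasing positions, equal odd letters
  from decreasing ones.\<close>

lemma standardization_iff:
  assumes \<sigma>: "\<sigma> permutes {1..n}" and w: "w \<in> {1..n} \<rightarrow>\<^sub>E {lo..hi}"
  shows "restrict (w \<circ> inv \<sigma>) {1..n} \<in> super_words lo hi n (descent (inv \<sigma>))
    \<longleftrightarrow> order_iso n (std_key n w) \<sigma>"
proof -
  have mem: "inv \<sigma> a \<in> {1..n}" if "a \<in> {1..n}" for a
    using that permutes_in_image[OF permutes_inv[OF \<sigma>]] by blast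
  have neq: "inv \<sigma> a \<noteq> inv \<sigma> (Suc a)" for a
    using permutes_inj[OF permutes_inv[OF \<sigma>]] by (metis injD n_not_Suc_n)
  have "restrict (w \<circ> inv \<sigma>) {1..n} \<in> {1..n} \<rightarrow>\<^sub>E {lo..hi}"
    using w mem by (auto simp: PiE_iff)
  moreover have "((w \<circ> inv \<sigma>) a < (w \<circ> inv \<sigma>) (Suc a) \<or>
      (w \<circ> inv \<sigma>) a = (w \<circ> inv \<sigma>) (Suc a) \<and> (descent (inv \<sigma>) a \<longleftrightarrow> odd ((w \<circ> inv \<sigma>) a)))
      \<longleftrightarrow> std_key n w (inv \<sigma> a) < std_key n w (inv \<sigma> (Suc a))" if "a \<in> {1..<n}" for a
    using that neq[of a] mem[of a] mem[of "Suc a"]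
    by (subst std_key_less_iff) (auto simp: descent_def)
  ultimately have "restrict (w \<circ> inv \<sigma>) {1..n} \<in> super_words lo hi n (descent (inv \<sigma>))
      \<longleftrightarrow> (\<forall>a\<in>{1..<n}. std_key n w (inv \<sigma> a) < std_key n w (inv \<sigma> (Suc a)))"
    by (simp add: super_words_def)
  then show ?thesis using increasing_iff_order_iso[OF \<sigma>] by simp
qed

lemma card_super_words_descent_inv:
  assumes \<sigma>: "\<sigma> permutes {1..n}"
  shows "card (super_words lo hi n (descent (inv \<sigma>))) =
    card {w \<in> {1..n} \<rightarrow>\<^sub>E {lo..hi}. order_iso n (std_key n w) \<sigma>}"
proof -
  have mem: "\<sigma> a \<in> {1..n}" "inv \<sigma> a \<in> {1..n}" if "a \<in> {1..n}" for a
    using that permutes_in_image[OF permutes_inv[OF \<sigma>]] permutes_in_image[OF \<sigma>] by blast+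
  have "bij_betw (\<lambda>w. restrict (w \<circ> inv \<sigma>) {1..n})
     {w \<in> {1..n} \<rightarrow>\<^sub>E {lo..hi}. order_iso n (std_key n w) \<sigma>} (super_words lo hi n (descent (inv \<sigma>)))"
  proof (rule bij_betw_byWitness[where f' = "\<lambda>f. restrict (f \<circ> \<sigma>) {1..n}"])
    show "\<forall>w\<in>{w \<in> {1..n} \<rightarrow>\<^sub>E {lo..hi}. order_iso n (std_key n w) \<sigma>}.
        restrict (restrict (w \<circ> inv \<sigma>) {1..n} \<circ> \<sigma>) {1..n} = w"
      using mem(1) permutes_inverses[OF \<sigma>] by (auto simp: fun_eq_iff PiE_iff extensional_def)
    have R: "restrict (restrict (f \<circ> \<sigma>) {1..n} \<circ> inv \<sigma>) {1..n} = f"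
      if "f \<in> {1..n} \<rightarrow>\<^sub>E {lo..hi}" for f
      using that mem(2) permutes_inverses[OF \<sigma>] by (auto simp: fun_eq_iff PiE_iff extensional_def)
    have PE: "super_words lo hi n (descent (inv \<sigma>)) \<subseteq> {1..n} \<rightarrow>\<^sub>E {lo..hi}"
      by (auto simp: super_words_def)
    show "\<forall>f\<in>super_words lo hi n (descent (inv \<sigma>)).
        restrict (restrict (f \<circ> \<sigma>) {1..n} \<circ> inv \<sigma>) {1..n} = f"
      using R PE by blast
    show "(\<lambda>w. restrict (w \<circ> inv \<sigma>) {1..n}) `
        {w \<in> {1..n} \<rightarrow>\<^sub>E {lo..hi}. order_iso n (std_key n w) \<sigma>}
        \<subseteq> super_words lo hi n (descent (inv \<sigma>))"
      using standardization_iff[OF \<sigma>] by blast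
    show "(\<lambda>f. restrict (f \<circ> \<sigma>) {1..n}) ` super_words lo hi n (descent (inv \<sigma>))
        \<subseteq> {w \<in> {1..n} \<rightarrow>\<^sub>E {lo..hi}. order_iso n (std_key n w) \<sigma>}"
    proof (rule image_subsetI)
      fix f assume f: "f \<in> super_words lo hi n (descent (inv \<sigma>))"
      then have fP: "f \<in> {1..n} \<rightarrow>\<^sub>E {lo..hi}" using PE by blast
      then have wP: "restrict (f \<circ> \<sigma>) {1..n} \<in> {1..n} \<rightarrow>\<^sub>E {lo..hi}"
        using mem(1) by (auto simp: PiE_iff)
      then show "restrict (f \<circ> \<sigma>) {1..n} \<in>
          {w \<in> {1..n} \<rightarrow>\<^sub>E {lo..hi}. order_iso n (std_key n w) \<sigma>}"
        using standardization_iff[OF \<sigma> wP] R[OF fP] f by simp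
    qed
  qed
  then show ?thesis by (simp add: bij_betw_same_card)
qed

lemma finite_perms: "finite (perms n)"
  unfolding perms_def by (rule finite_permutations) simp

text \<open>Every word has exactly one standardization, so after exchanging the sums each word
  retains a single term.\<close>

lemma sum_over_standardizations:
  fixes F :: "(nat \<Rightarrow> nat) \<Rightarrow> nat"
  assumes G: "\<And>\<sigma> w. \<sigma> \<in> perms n \<Longrightarrow> order_iso n (std_key n w) \<sigma> \<Longrightarrow> F \<sigma> = G w"
  shows "(\<Sum>\<sigma>\<in>perms n. F \<sigma> * card (super_words lo hi n (descent (inv \<sigma>)))) =
    (\<Sum>w\<in>{1..n} \<rightarrow>\<^sub>E {lo..hi}. G w)"
proof -
  let ?W = "{1..n} \<rightarrow>\<^sub>E {lo..hi}"
  have fin: "finite ?W" by (auto intro: finite_PiE)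
  have "(\<Sum>\<sigma>\<in>perms n. F \<sigma> * card (super_words lo hi n (descent (inv \<sigma>))))
      = (\<Sum>\<sigma>\<in>perms n. \<Sum>w\<in>{w \<in> ?W. order_iso n (std_key n w) \<sigma>}. F \<sigma>)"
    by (intro sum.cong) (auto simp: card_super_words_descent_inv perms_def)
  also have "\<dots> = (\<Sum>w\<in>?W. \<Sum>\<sigma>\<in>{\<sigma> \<in> perms n. order_iso n (std_key n w) \<sigma>}. F \<sigma>)"
    by (rule sum.swap_restrict[OF finite_perms fin])
  also have "\<dots> = (\<Sum>w\<in>?W. G w)"
  proof (rule sum.cong[OF refl])
    fix w
    obtain \<sigma> where s: "\<sigma> permutes {1..n}" "order_iso n (std_key n w) \<sigma>"
      using order_iso_exists[OF inj_on_std_key] by blast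
    have "\<tau> = \<sigma>" if "\<tau> \<in> perms n" "order_iso n (std_key n w) \<tau>" for \<tau>
      using order_iso_unique[OF _ that(2) s] that(1) by (simp add: perms_def)
    moreover have "\<sigma> \<in> perms n" using s by (simp add: perms_def)
    ultimately have "{\<sigma> \<in> perms n. order_iso n (std_key n w) \<sigma>} = {\<sigma>}"
      using s(2) by blast
    then show "(\<Sum>\<sigma>\<in>{\<sigma> \<in> perms n. order_iso n (std_key n w) \<sigma>}. F \<sigma>) = G w"
      using G[of \<sigma> w] s by (simp add: perms_def)
  qed
  finally show ?thesis .
qed

lemma bij_betw_inv_perms: "bij_betw inv (perms n) (perms n)"
  by (rule bij_betw_byWitness[where f' = inv])
    (auto simp: perms_def permutes_inv permutes_inv_inv)

lemma sum_card_super_words: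
  "(\<Sum>\<pi>\<in>perms n. card (super_words lo hi n (descent \<pi>))) = (Suc hi - lo) ^ n"
proof -
  have "(\<Sum>\<pi>\<in>perms n. card (super_words lo hi n (descent \<pi>)))
      = (\<Sum>\<sigma>\<in>perms n. 1 * card (super_words lo hi n (descent (inv \<sigma>))))"
    using sum.reindex_bij_betw[OF bij_betw_inv_perms,
        of "\<lambda>\<pi>. card (super_words lo hi n (descent \<pi>))" n] by simp
  also have "\<dots> = (\<Sum>w\<in>{1..n} \<rightarrow>\<^sub>E {lo..hi}. 1)"
    by (rule sum_over_standardizations) simp
  also have "\<dots> = (Suc hi - lo) ^ n" by (simp add: card_PiE)
  finally show ?thesis .
qed

text \<open>The first factor depends on the descents of \<open>\<sigma>\<close> only, and these can
  be read off any word that \<open>\<sigma>\<close> standardizes.\<close>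

lemma sum_card_super_words_pairs:
  "(\<Sum>\<sigma>\<in>perms n. card (super_words lo' hi' n (descent \<sigma>)) * card (super_words lo hi n (descent (inv \<sigma>)))) =
    (\<Sum>w\<in>{1..n} \<rightarrow>\<^sub>E {lo..hi}. card (super_words lo' hi' n (super_descent w)))"
proof (rule sum_over_standardizations)
  fix \<sigma> w assume "\<sigma> \<in> perms n" and iso: "order_iso n (std_key n w) \<sigma>"
  have "descent \<sigma> i = super_descent w i" if i: "i \<in> {1..<n}" for i
  proof -
    have "descent \<sigma> i \<longleftrightarrow> std_key n w (Suc i) < std_key n w i"
      using iso i by (simp add: order_iso_def descent_def)
    also have "\<dots> \<longleftrightarrow> super_descent w i"
      using i by (subst std_key_less_iff) (auto simp: super_descent_def)
    finally show ?thesis .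
  qed
  then show "card (super_words lo' hi' n (descent \<sigma>)) = card (super_words lo' hi' n (super_descent w))"
    using super_words_cong by metis
qed

section \<open>Pairs of words\<close>

text \<open>Reading the rows of the array of pairs \<open>(g, w)\<close> alternately backwards and forwards makes the
  parity of \<open>g + w\<close> agree with the parity of the position.\<close>

definition pair_code :: "nat \<Rightarrow> nat \<Rightarrow> nat \<Rightarrow> nat" where
  "pair_code k g w = (g - 1) * (2 * k + 1) + (if even g then w else 2 * k - w) + 1"

text \<open>Row \<open>g\<close> is a block of length \<open>2 k + 1\<close>; odd rows run
  backwards, which reverses the comparison.\<close>

lemma pair_code_less_iff:
  assumes "1 \<le> g" "1 \<le> g'" "w \<le> 2 * k" "w' \<le> 2 * k"
  shows "pair_code k g w < pair_code k g' w' \<longleftrightarrow>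
    g < g' \<or> g = g' \<and> (if even g then w < w' else w' < w)"
proof -
  have "pair_code k g w < pair_code k g' w' \<longleftrightarrow>
    g - 1 < g' - 1 \<or> g - 1 = g' - 1 \<and>
      (if even g then w else 2 * k - w) < (if even g' then w' else 2 * k - w')"
    unfolding pair_code_def using assms by (subst add_less_cancel_right, subst block_less_iff) auto
  also have "\<dots> \<longleftrightarrow> g < g' \<or> g = g' \<and> (if even g then w < w' else w' < w)"
  proof -
    have "g - 1 < g' - 1 \<longleftrightarrow> g < g'" "g - 1 = g' - 1 \<longleftrightarrow> g = g'" using assms by auto
    then show ?thesis using assms by auto
  qed
  finally show ?thesis .
qed

text \<open>The row length is odd, so \<open>(g - 1) * (2 * k + 1) + 1\<close> has the parity of
  \<open>g\<close>, and reflection in \<open>2 * k\<close> preserves the parity of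
  \<open>w\<close>.\<close>

lemma even_pair_code:
  assumes "1 \<le> g" "w \<le> 2 * k"
  shows "even (pair_code k g w) \<longleftrightarrow> (even g \<longleftrightarrow> even w)"
proof -
  have "even (2 * k - w) \<longleftrightarrow> even w" using assms by simp
  then show ?thesis using assms by (cases g) (auto simp: pair_code_def)
qed

lemma bij_betw_pair_code:
  "bij_betw (\<lambda>(g, w). pair_code k g w) ({1..m} \<times> {0..2 * k}) {1..m * (2 * k + 1)}"
proof -
  have inj: "inj_on (\<lambda>(g, w). pair_code k g w) ({1..m} \<times> {0..2 * k})"
  proof (rule inj_onI, clarify)
    fix g w g' w' assume "g \<in> {1..m}" "w \<in> {0..2 * k}" "g' \<in> {1..m}" "w' \<in> {0..2 * k}"
      and "pair_code k g w = pair_code k g' w'"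
    then show "g = g' \<and> w = w'"
      using pair_code_less_iff[of g g' w k w'] pair_code_less_iff[of g' g w' k w]
      by (auto split: if_splits)
  qed
  have "(\<lambda>(g, w). pair_code k g w) ` ({1..m} \<times> {0..2 * k}) \<subseteq> {1..m * (2 * k + 1)}"
  proof clarify
    fix g w assume g: "g \<in> {1..m}" and w: "w \<in> {0..2 * k}"
    have "(g - 1) * (2 * k + 1) + (if even g then w else 2 * k - w) < m * (2 * k + 1) + 0"
      using g w by (intro block_less) auto
    then show "pair_code k g w \<in> {1..m * (2 * k + 1)}" by (simp add: pair_code_def)
  qed
  moreover have "card ((\<lambda>(g, w). pair_code k g w) ` ({1..m} \<times> {0..2 * k})) = card {1..m * (2 * k + 1)}"
    using inj by (simp add: card_image)
  ultimately show ?thesis using inj by (simp add: bij_betw_def card_subset_eq)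
qed

text \<open>Pairs of words are encoded letter by letter. For equal even letters of \<open>g\<close>
  the condition says that \<open>w\<close> rises or repeats an even letter, for equal odd ones that
  it falls or repeats an odd letter. In each case the code rises or repeats an even value.\<close>

lemma sum_card_super_words_super_descent:
  "(\<Sum>w\<in>{1..n} \<rightarrow>\<^sub>E {0..2 * k}. card (super_words 1 m n (super_descent w))) =
    card (super_words 1 (m * (2 * k + 1)) n (\<lambda>_. False))"
proof -
  let ?W = "{1..n} \<rightarrow>\<^sub>E {0..2 * k}"
  let ?c = "\<lambda>(g, w). pair_code k g w"
  let ?\<Phi> = "\<lambda>(w, g). restrict (\<lambda>i. pair_code k (g i) (w i)) {1..n}"
  note bij = bij_betw_pair_code[of k m]
  have P: "super_words 1 m n D \<subseteq> {1..n} \<rightarrow>\<^sub>E {1..m}" for m D by (auto simp: super_words_def)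
  have fin: "finite ?W" by (auto intro: finite_PiE)
  have code: "?c (g, w) \<in> {1..m * (2 * k + 1)}" if "g \<in> {1..m}" "w \<in> {0..2 * k}" for g w
    using bij_betw_apply[OF bij] that by blast
  have "bij_betw ?\<Phi> (SIGMA w:?W. super_words 1 m n (super_descent w))
      (super_words 1 (m * (2 * k + 1)) n (\<lambda>_. False))"
  proof (rule bij_betw_imageI)
    show "inj_on ?\<Phi> (SIGMA w:?W. super_words 1 m n (super_descent w))"
    proof (rule inj_onI, clarify)
      fix w g w' g'
      assume w: "w \<in> ?W" "w' \<in> ?W"
        and g: "g \<in> super_words 1 m n (super_descent w)" "g' \<in> super_words 1 m n (super_descent w')"
        and eq: "restrict (\<lambda>i. pair_code k (g i) (w i)) {1..n}
          = restrict (\<lambda>i. pair_code k (g' i) (w' i)) {1..n}"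
      have g: "g \<in> {1..n} \<rightarrow>\<^sub>E {1..m}" "g' \<in> {1..n} \<rightarrow>\<^sub>E {1..m}" using g P by blast+
      have "g i = g' i \<and> w i = w' i" if i: "i \<in> {1..n}" for i
      proof -
        have "?c (g i, w i) = ?c (g' i, w' i)" using fun_cong[OF eq, of i] i by simp
        then have "(g i, w i) = (g' i, w' i)"
          by (rule inj_onD[OF bij_betw_imp_inj_on[OF bij]]) (use w g i in \<open>auto simp: PiE_iff\<close>)
        then show ?thesis by simp
      qed
      then show "w = w' \<and> g = g'"
        using PiE_ext[OF w] PiE_ext[OF g] by blast
    qed
    show "?\<Phi> ` (SIGMA w:?W. super_words 1 m n (super_descent w))
        = super_words 1 (m * (2 * k + 1)) n (\<lambda>_. False)" (is "?L = ?R")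
    proof -
      have cond: "restrict (\<lambda>i. pair_code k (g i) (w i)) {1..n} \<in> ?R
          \<longleftrightarrow> g \<in> super_words 1 m n (super_descent w)"
        if w: "w \<in> ?W" and g: "g \<in> {1..n} \<rightarrow>\<^sub>E {1..m}" for w g
      proof -
        let ?h = "\<lambda>i. pair_code k (g i) (w i)"
        have gi: "1 \<le> g i" "g i \<le> m" and wi: "w i \<le> 2 * k" if "i \<in> {1..n}" for i
          using w g that by (auto simp: PiE_iff)
        have "restrict ?h {1..n} \<in> {1..n} \<rightarrow>\<^sub>E {1..m * (2 * k + 1)}"
          using code gi wi by (auto simp: PiE_iff)
        moreover have "(?h i < ?h (Suc i) \<or> ?h i = ?h (Suc i) \<and> (False \<longleftrightarrow> odd (?h i)))
          \<longleftrightarrow> (g i < g (Suc i) \<or> g i = g (Suc i) \<and> (super_descent w i \<longleftrightarrow> odd (g i)))"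
          if i: "i \<in> {1..<n}" for i
        proof -
          have i': "i \<in> {1..n}" "Suc i \<in> {1..n}" using i by auto
          note b = gi[OF i'(1)] gi[OF i'(2)] wi[OF i'(1)] wi[OF i'(2)]
          have lt: "?h i < ?h (Suc i) \<longleftrightarrow>
              g i < g (Suc i) \<or> g i = g (Suc i) \<and> (if even (g i) then w i < w (Suc i) else w (Suc i) < w i)"
            using b by (intro pair_code_less_iff) auto
          have gt: "?h (Suc i) < ?h i \<longleftrightarrow>
              g (Suc i) < g i \<or> g (Suc i) = g i \<and>
                (if even (g (Suc i)) then w (Suc i) < w i else w i < w (Suc i))"
            using b by (intro pair_code_less_iff) auto
          have ev: "even (?h i) \<longleftrightarrow> (even (g i) \<longleftrightarrow> even (w i))"
            using b by (intro even_pair_code) auto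
          have eq: "?h i = ?h (Suc i) \<longleftrightarrow> g i = g (Suc i) \<and> w i = w (Suc i)"
          proof -
            have "?h i = ?h (Suc i) \<longleftrightarrow> \<not> ?h i < ?h (Suc i) \<and> \<not> ?h (Suc i) < ?h i" by linarith
            then show ?thesis unfolding lt gt
              by (cases "g i" "g (Suc i)" rule: linorder_cases;
                  cases "w i" "w (Suc i)" rule: linorder_cases) auto
          qed
          show ?thesis unfolding lt eq ev super_descent_def
            by (cases "w i" "w (Suc i)" rule: linorder_cases) auto
        qed
        ultimately show ?thesis using g by (simp add: super_words_def)
      qed
      show ?thesis
      proof
        show "?L \<subseteq> ?R"
        proof (rule image_subsetI)
          fix x assume "x \<in> (SIGMA w:?W. super_words 1 m n (super_descent w))"
          then obtain w g where x: "x = (w, g)" "w \<in> ?W" "g \<in> super_words 1 m n (super_descent w)"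
            by blast
          have "g \<in> {1..n} \<rightarrow>\<^sub>E {1..m}" using x(3) P by blast
          then show "?\<Phi> x \<in> ?R" using cond[OF x(2)] x(1,3) by simp
        qed
        show "?R \<subseteq> ?L"
        proof
          fix h assume h: "h \<in> ?R"
          then have hP: "h \<in> {1..n} \<rightarrow>\<^sub>E {1..m * (2 * k + 1)}" using P by blast
          \<comment> \<open>Decoding each letter of \<open>h\<close> separately supplies the
            preimage.\<close>
          define e where "e = inv_into ({1..m} \<times> {0..2 * k}) ?c"
          have e: "e c \<in> {1..m} \<times> {0..2 * k}" "?c (e c) = c" if "c \<in> {1..m * (2 * k + 1)}" for c
            using that inv_into_into[of c ?c "{1..m} \<times> {0..2 * k}"]
              f_inv_into_f[of c ?c "{1..m} \<times> {0..2 * k}"]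
            unfolding bij_betw_imp_surj_on[OF bij] e_def by blast+
          define g where "g = restrict (\<lambda>i. fst (e (h i))) {1..n}"
          define w where "w = restrict (\<lambda>i. snd (e (h i))) {1..n}"
          have hi: "h i \<in> {1..m * (2 * k + 1)}" if "i \<in> {1..n}" for i using hP that by blast
          have gP: "g \<in> {1..n} \<rightarrow>\<^sub>E {1..m}" and wP: "w \<in> ?W"
            using e(1)[OF hi] unfolding g_def w_def by (auto simp: PiE_iff mem_Times_iff)
          have heq: "h = restrict (\<lambda>i. pair_code k (g i) (w i)) {1..n}"
          proof
            fix i
            show "h i = restrict (\<lambda>i. pair_code k (g i) (w i)) {1..n} i"
              using e(2)[OF hi, of i] hP
              by (cases "i \<in> {1..n}") (auto simp: g_def w_def split_def PiE_iff extensional_def)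
          qed
          have "g \<in> super_words 1 m n (super_descent w)"
            using cond[OF wP gP] h unfolding heq[symmetric] by blast
          then show "h \<in> ?L" using wP heq by (intro image_eqI[of _ _ "(w, g)"]) auto
        qed
      qed
    qed
  qed
  then have "card (super_words 1 (m * (2 * k + 1)) n (\<lambda>_. False))
      = card (SIGMA w:?W. super_words 1 m n (super_descent w))" by (simp add: bij_betw_same_card)
  also have "\<dots> = (\<Sum>w\<in>?W. card (super_words 1 m n (super_descent w)))"
    using fin finite_super_words by (intro card_SigmaI) auto
  finally show ?thesis by simp
qed

section \<open>Words of the identity permutation\<close>

text \<open>Setting \<open>D 0\<close> to true matches the lower bound 1; without descents at
  positive positions there are no peaks.\<close>

lemma fps_super_words_increasing:
  assumes "n \<ge> 1"
  shows "Abs_fps (\<lambda>k. of_nat (card (super_words 1 (2 * k) n (\<lambda>_. False)))) =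
    fps_const (1/2) * fps_R * fps_S * (fps_R ^ n :: 'a::field_char_0 fps)"
proof -
  have "super_words 1 hi n (\<lambda>_. False) = super_words 1 hi n (\<lambda>i. i = 0)" for hi
    by (rule super_words_cong) auto
  moreover have "peak_count n (\<lambda>i. i = 0) = 0" by (simp add: peak_count_def)
  ultimately show ?thesis using fps_super_words[of 1 "\<lambda>i. i = 0" n] assms by simp
qed

text \<open>One more letter multiplies the generating function by \<open>fps_R\<close>. This is the
  difference equation of \<open>odd_cycle_poly\<close> in steps of 2, and for length above 1 both
  sides vanish at \<open>L = 0\<close>.\<close>

lemma fact_mult_card_increasing_super_words:
  assumes "n \<ge> 1"
  shows "fact n * of_nat (card (super_words 1 (2 * L) n (\<lambda>_. False))) =
    (odd_cycle_poly n (2 * of_nat L) :: 'a::field_char_0)"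
  using assms
proof (induction n arbitrary: L rule: nat_induct_at_least)
  case base
  have "super_words 1 (2 * L) 1 (\<lambda>_. False) = {1} \<rightarrow>\<^sub>E {1..2 * L}"
    by (simp add: super_words_def)
  then show ?case by (simp add: card_PiE odd_cycle_poly_1)
next
  case (Suc n)
  define A where "A n = Abs_fps (\<lambda>L. of_nat (card (super_words 1 (2 * L) n (\<lambda>_. False))) :: 'a)" for n
  have A: "A m = fps_const (1/2) * fps_R * fps_S * fps_R ^ m" if "m \<ge> 1" for m
    unfolding A_def using fps_super_words_increasing[OF that] .
  have "A (Suc n) = A n * fps_R" using Suc(1) by (simp add: A)
  then have rec: "(1 - fps_X) * A (Suc n) = (1 + fps_X) * A n"
    using inverse_one_minus_X[where 'a = 'a] unfolding fps_R_def by algebra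
  have step: "A (Suc n) $ Suc l = A (Suc n) $ l + A n $ Suc l + A n $ l" for l
    using arg_cong[OF rec, of "\<lambda>f. f $ Suc l"] by (simp add: left_diff_distrib distrib_right algebra_simps)
  have IH: "fact n * A n $ l = odd_cycle_poly n (2 * of_nat l)" for l
    using Suc.IH by (simp add: A_def)
  have "fact (Suc n) * A (Suc n) $ L = odd_cycle_poly (Suc n) (2 * of_nat L)"
  proof (induction L)
    case 0
    have "A (Suc n) $ 0 = 0" using Suc(1) by (simp add: A fps_S_nth_0)
    moreover have "odd_cycle_poly (Suc n) (0 :: 'a) = 0"
      unfolding odd_cycle_poly_def
      by (rule sum.neutral) (auto simp: odd_cycle_number_eq_0 power_0_left)
    ultimately show ?case by simp
  next
    case (Suc l)
    have "fact (Suc n) * A (Suc n) $ Suc l = fact (Suc n) * A (Suc n) $ l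
        + of_nat (Suc n) * (fact n * A n $ Suc l + fact n * A n $ l)"
      by (simp add: step algebra_simps)
    also have "\<dots> = odd_cycle_poly (Suc n) (2 * of_nat l) + of_nat (Suc n) *
        (odd_cycle_poly n (2 * of_nat l + 2) + odd_cycle_poly n (2 * of_nat l))"
      unfolding Suc.IH IH by (simp add: algebra_simps)
    also have "\<dots> = odd_cycle_poly (Suc n) (2 * of_nat l + 2)"
      using odd_cycle_poly_diff[of n "2 * of_nat l :: 'a"] by (simp add: algebra_simps)
    finally show ?case by (simp add: algebra_simps)
  qed
  then show ?case by (simp add: A_def)
qed

section \<open>Comparison of generating functions\<close>

text \<open>Adjacent values differ, so a position that is not a descent is an ascent; the value
  false at 0 admits an initial descent.\<close>

lemma lpk_eq_peak_count:
  assumes "\<pi> \<in> perms n"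
  shows "lpk n \<pi> = peak_count n (\<lambda>i. i \<noteq> 0 \<and> descent \<pi> i)"
proof -
  have inj: "\<pi> i \<noteq> \<pi> (Suc i)" for i
    using assms permutes_inj by (metis injD mem_Collect_eq n_not_Suc_n perms_def)
  have "is_left_peak n \<pi> i \<longleftrightarrow>
      i \<in> {1..<n} \<and> (i \<noteq> 0 \<and> descent \<pi> i) \<and> \<not> (i - 1 \<noteq> 0 \<and> descent \<pi> (i - 1))" for i
  proof (cases "i \<le> 1")
    case True
    then show ?thesis
      by (cases i) (auto simp: is_left_peak_def is_peak_def descent_def numeral_2_eq_2)
  next
    case False
    then obtain j where i: "i = Suc j" "j \<ge> 1" by (cases i) auto
    have "\<pi> j < \<pi> (Suc j) \<longleftrightarrow> \<not> \<pi> (Suc j) < \<pi> j" using inj[of j] by auto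
    then show ?thesis using i by (auto simp: is_left_peak_def is_peak_def descent_def)
  qed
  then have "{i. is_left_peak n \<pi> i} =
      {i \<in> {1..<n}. (i \<noteq> 0 \<and> descent \<pi> i) \<and> \<not> (i - 1 \<noteq> 0 \<and> descent \<pi> (i - 1))}" by blast
  then show ?thesis by (simp only: lpk_def peak_count_def)
qed

lemma pk_eq_peak_count:
  assumes "\<pi> \<in> perms n"
  shows "pk n \<pi> = peak_count n (\<lambda>i. i = 0 \<or> descent \<pi> i)"
proof -
  have inj: "\<pi> i \<noteq> \<pi> (Suc i)" for i
    using assms permutes_inj by (metis injD mem_Collect_eq n_not_Suc_n perms_def)
  have "is_peak n \<pi> i \<longleftrightarrow>
      i \<in> {1..<n} \<and> (i = 0 \<or> descent \<pi> i) \<and> \<not> (i - 1 = 0 \<or> descent \<pi> (i - 1))" for i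
  proof (cases "i \<le> 1")
    case True
    then show ?thesis by (auto simp: is_peak_def)
  next
    case False
    then obtain j where i: "i = Suc j" "j \<ge> 1" by (cases i) auto
    have "\<pi> j < \<pi> (Suc j) \<longleftrightarrow> \<not> \<pi> (Suc j) < \<pi> j" using inj[of j] by auto
    then show ?thesis using i by (auto simp: is_peak_def descent_def)
  qed
  then have "{i. is_peak n \<pi> i} =
      {i \<in> {1..<n}. (i = 0 \<or> descent \<pi> i) \<and> \<not> (i - 1 = 0 \<or> descent \<pi> (i - 1))}" by blast
  then show ?thesis by (simp only: pk_def peak_count_def)
qed

lemma fps_super_words_lpk:
  assumes "n \<ge> 1" "\<pi> \<in> perms n"
  shows "Abs_fps (\<lambda>k. of_nat (card (super_words 0 (2 * k) n (descent \<pi>)))) =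
    inverse (1 - fps_X) * fps_R ^ n * (fps_S ^ lpk n \<pi> :: 'a::field_char_0 fps)"
proof -
  let ?D = "\<lambda>i. i \<noteq> 0 \<and> descent \<pi> i"
  have "super_words 0 hi n (descent \<pi>) = super_words 0 hi n ?D" for hi
    by (rule super_words_cong) auto
  then show ?thesis
    using fps_super_words[of 0 ?D n] assms lpk_eq_peak_count[OF assms(2)] by simp
qed

lemma fps_super_words_pk:
  assumes "n \<ge> 1" "\<pi> \<in> perms n"
  shows "Abs_fps (\<lambda>k. of_nat (card (super_words 1 (2 * k) n (descent \<pi>)))) =
    (fps_const (1/2) * fps_R) * fps_R ^ n * (fps_S ^ (pk n \<pi> + 1) :: 'a::field_char_0 fps)"
proof -
  let ?D = "\<lambda>i. i = 0 \<or> descent \<pi> i"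
  have "super_words 1 hi n (descent \<pi>) = super_words 1 hi n ?D" for hi
    by (rule super_words_cong) auto
  then show ?thesis
    using fps_super_words[of 1 ?D n] assms pk_eq_peak_count[OF assms(2)]
    by (simp add: algebra_simps)
qed

text \<open>Summing \<open>eq\<close> over powers of \<open>X\<close> gives the claim with
  \<open>fps_S\<close> for \<open>x\<close>, up to the factor \<open>K * fps_R ^ n\<close>;
  \<open>fps_S\<close> is transcendental. The general weights allow one use for each of the two
  variables.\<close>

lemma polynomial_identity_from_coefficients:
  fixes K :: "'a::field_char_0 fps" and a :: "(nat \<Rightarrow> nat) \<Rightarrow> 'a" and b :: "nat \<Rightarrow> 'a"
  assumes K: "K \<noteq> 0"
    and c: "\<And>j \<pi>. j \<ge> 1 \<Longrightarrow> \<pi> \<in> perms j \<Longrightarrow> Abs_fps (c j \<pi>) = K * fps_R ^ j * fps_S ^ e j \<pi>"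
    and n: "n \<ge> 1"
    and b: "\<And>j. j \<le> n \<Longrightarrow> j = 0 \<or> odd (n - j) \<Longrightarrow> b j = 0"
    and eq: "\<And>m. (\<Sum>\<pi>\<in>perms n. a \<pi> * c n \<pi> m) = (\<Sum>j=0..n. b j * (\<Sum>\<sigma>\<in>perms j. c j \<sigma> m))"
  shows "(\<Sum>\<pi>\<in>perms n. a \<pi> * x ^ e n \<pi>) =
    (\<Sum>j=0..n. b j * (1 - x) ^ ((n - j) div 2) * (\<Sum>\<sigma>\<in>perms j. x ^ e j \<sigma>))"
proof -
  \<comment> \<open>The two sides as polynomials in the variable that \<open>fps_S\<close> is
    substituted for.\<close>
  define p where "p = (\<Sum>\<pi>\<in>perms n. monom (a \<pi>) (e n \<pi>))"
  define q where "q = (\<Sum>j=0..n. smult (b j) ([:1, -1:] ^ ((n - j) div 2) * (\<Sum>\<sigma>\<in>perms j. monom 1 (e j \<sigma>))))"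
  note S0 = fps_S_nth_0[where 'a = 'a]
  have X: "fps_X oo fps_S = (fps_S :: 'a fps)" by (rule fps_X_fps_compose_startby0) (rule S0)
  have monom: "fps_of_poly (monom r i) oo fps_S = fps_const r * fps_S ^ i" for r :: 'a and i
    by (simp add: fps_of_poly_monom fps_compose_mult_distrib[OF S0] fps_compose_power[OF S0, symmetric] X)
  have lin: "fps_of_poly [:1, -1 :: 'a:] = 1 - fps_X"
    by (simp add: fps_of_poly_linear' fps_const_neg[symmetric] del: fps_const_neg)
  have P: "fps_of_poly p oo fps_S = (\<Sum>\<pi>\<in>perms n. fps_const (a \<pi>) * fps_S ^ e n \<pi>)"
    by (simp add: p_def fps_of_poly_sum fps_compose_sum_distrib monom)
  have Q: "fps_of_poly q oo fps_S = (\<Sum>j=0..n. fps_const (b j) * (1 - fps_S) ^ ((n - j) div 2)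
      * (\<Sum>\<sigma>\<in>perms j. fps_S ^ e j \<sigma>))"
    by (simp add: q_def fps_of_poly_sum fps_compose_sum_distrib monom fps_of_poly_mult
        fps_of_poly_power lin fps_compose_mult_distrib[OF S0] fps_compose_power[OF S0, symmetric]
        fps_compose_sub_distrib X fps_of_poly_smult mult.assoc)
  have "K * fps_R ^ n * (fps_of_poly p oo fps_S) = (\<Sum>\<pi>\<in>perms n. fps_const (a \<pi>) * Abs_fps (c n \<pi>))"
    unfolding P sum_distrib_left by (intro sum.cong refl) (simp add: c[OF n] mult_ac)
  also have "\<dots> = (\<Sum>j=0..n. fps_const (b j) * (\<Sum>\<sigma>\<in>perms j. Abs_fps (c j \<sigma>)))"
    by (rule fps_ext) (simp add: fps_sum_nth eq)
  also have "\<dots> = K * fps_R ^ n * (fps_of_poly q oo fps_S)"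
    unfolding Q sum_distrib_left[of "K * fps_R ^ n"]
  proof (intro sum.cong refl)
    fix j assume j: "j \<in> {0..n}"
    show "fps_const (b j) * (\<Sum>\<sigma>\<in>perms j. Abs_fps (c j \<sigma>)) = K * fps_R ^ n *
        (fps_const (b j) * (1 - fps_S) ^ ((n - j) div 2) * (\<Sum>\<sigma>\<in>perms j. fps_S ^ e j \<sigma>))"
    proof (cases "j = 0 \<or> odd (n - j)")
      case True
      then show ?thesis using b j by simp
    next
      case False
      then obtain i where i: "n - j = 2 * i" by (meson evenE)
      then have "n = j + 2 * i" using j by auto
      \<comment> \<open>The surplus \<open>fps_R ^ (2 * i)\<close> is cancelled by
        \<open>(1 - fps_S) ^ i\<close>.\<close>
      then have "fps_R ^ n * (1 - fps_S) ^ i = fps_R ^ j * (fps_R ^ 2 * (1 - fps_S :: 'a fps)) ^ i"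
        by (simp add: power_add power_mult power_mult_distrib)
      then have R: "fps_R ^ n * (1 - fps_S) ^ i = (fps_R ^ j :: 'a fps)"
        by (simp add: fps_R_squared)
      have "(\<Sum>\<sigma>\<in>perms j. Abs_fps (c j \<sigma>)) = K * fps_R ^ j * (\<Sum>\<sigma>\<in>perms j. fps_S ^ e j \<sigma>)"
        unfolding sum_distrib_left using False by (intro sum.cong refl c) auto
      then show ?thesis unfolding R[symmetric] i by (simp add: mult_ac)
    qed
  qed
  finally have "K * fps_R ^ n * ((fps_of_poly p - fps_of_poly q) oo fps_S) = 0"
    by (simp add: fps_compose_sub_distrib right_diff_distrib)
  then have "(fps_of_poly p - fps_of_poly q) oo fps_S = 0"
    using K fps_R_neq_0[where 'a = 'a] by simp
  \<comment> \<open>Substituting a nonzero series without constant term is injective.\<close>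
  then have "fps_of_poly p - fps_of_poly q = 0"
    using fps_compose_eq_0_iff[OF S0] fps_S_neq_0[where 'a = 'a] by blast
  then have "p = q" by (simp add: fps_of_poly_eq_iff)
  then have "poly p x = poly q x" by simp
  then show ?thesis by (simp add: p_def q_def poly_sum poly_monom poly_power mult.assoc)
qed

theorem theorem4p8:
  fixes n :: nat and s t :: "'a::field_char_0"
  assumes "n \<ge> 1"
  shows "P_lpk_ipk n s t =
    1 / fact n * (\<Sum>k=0..n. of_nat (d n k) * ((1 - s) * (1 - t)) ^ ((n - k) div 2)
      * P_lpk k s * P_pk k t)"
proof -
  define \<delta> :: "nat \<Rightarrow> 'a" where "\<delta> j = of_nat (d n j) / fact n" for j
  define U :: "nat \<Rightarrow> (nat \<Rightarrow> nat) \<Rightarrow> nat \<Rightarrow> 'a"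
    where "U j \<pi> k = of_nat (card (super_words 0 (2 * k) j (descent \<pi>)))" for j \<pi> k
  define V :: "nat \<Rightarrow> (nat \<Rightarrow> nat) \<Rightarrow> nat \<Rightarrow> 'a"
    where "V j \<pi> l = of_nat (card (super_words 1 (2 * l) j (descent \<pi>)))" for j \<pi> l
  define A where "A j = (\<Sum>\<sigma>\<in>perms j. s ^ lpk j \<sigma>)" for j
  define B where "B j = (\<Sum>\<sigma>\<in>perms j. t ^ (pk j \<sigma> + 1))" for j
  have \<delta>0: "\<delta> j = 0" if "j \<le> n" "j = 0 \<or> odd (n - j)" for j
  proof -
    have "odd_cycle_number n j = 0" using that assms by (intro odd_cycle_number_eq_0) auto
    then show ?thesis by (simp add: \<delta>_def d_eq)
  qed
  have sumU: "(\<Sum>\<pi>\<in>perms j. U j \<pi> k) = (2 * of_nat k + 1) ^ j" for j k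
    using arg_cong[OF sum_card_super_words[of 0 "2 * k" j], of "of_nat :: nat \<Rightarrow> 'a"]
    by (simp add: U_def algebra_simps)
  have sumV: "(\<Sum>\<pi>\<in>perms j. V j \<pi> l) = (2 * of_nat l) ^ j" for j l
    using arg_cong[OF sum_card_super_words[of 1 "2 * l" j], of "of_nat :: nat \<Rightarrow> 'a"]
    by (simp add: V_def)
  have reindex: "(\<Sum>\<sigma>\<in>perms n. f \<sigma> (inv \<sigma>)) = (\<Sum>\<pi>\<in>perms n. f (inv \<pi>) \<pi>)"
    for f :: "(nat \<Rightarrow> nat) \<Rightarrow> (nat \<Rightarrow> nat) \<Rightarrow> 'a"
  proof -
    have "(\<Sum>\<pi>\<in>perms n. f (inv \<pi>) \<pi>) = (\<Sum>\<pi>\<in>perms n. f (inv \<pi>) (inv (inv \<pi>)))"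
      by (intro sum.cong) (auto simp: perms_def permutes_inv_inv)
    also have "\<dots> = (\<Sum>\<sigma>\<in>perms n. f \<sigma> (inv \<sigma>))"
      by (rule sum.reindex_bij_betw[OF bij_betw_inv_perms])
    finally show ?thesis by simp
  qed
  \<comment> \<open>The left side counts pairs of words, hence words of the identity over
    \<open>2 l (2 k + 1)\<close> letters. The odd cycle polynomial expands this count in powers, and
    \<open>sumU\<close> resolves \<open>(2 k + 1) ^ j\<close> again.\<close>
  have key: "(\<Sum>\<pi>\<in>perms n. V n (inv \<pi>) l * U n \<pi> k) =
      (\<Sum>j=0..n. \<delta> j * (2 * of_nat l) ^ j * (\<Sum>\<sigma>\<in>perms j. U j \<sigma> k))" for k l
  proof -
    have "(\<Sum>\<pi>\<in>perms n. V n (inv \<pi>) l * U n \<pi> k) = (\<Sum>\<sigma>\<in>perms n. V n \<sigma> l * U n (inv \<sigma>) k)"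
      by (rule reindex[symmetric, of "\<lambda>\<sigma> \<pi>. V n \<sigma> l * U n \<pi> k"])
    also have "\<dots> = of_nat (card (super_words 1 (2 * l * (2 * k + 1)) n (\<lambda>_. False)))"
      using arg_cong[OF sum_card_super_words_pairs[of 1 "2 * l" n 0 "2 * k"], of "of_nat :: nat \<Rightarrow> 'a"]
      unfolding sum_card_super_words_super_descent by (simp add: U_def V_def)
    also have "\<dots> = odd_cycle_poly n (2 * of_nat (l * (2 * k + 1))) / fact n"
      using fact_mult_card_increasing_super_words[OF assms, of "l * (2 * k + 1)", where 'a = 'a]
      by (simp add: field_simps mult.assoc)
    also have "\<dots> = (\<Sum>j=0..n. \<delta> j * (2 * of_nat l) ^ j * (2 * of_nat k + 1) ^ j)"
    proof -
      have pw: "(2 * of_nat (l * (2 * k + 1))) ^ j = (2 * of_nat l) ^ j * (2 * of_nat k + 1 :: 'a) ^ j" for j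
        unfolding power_mult_distrib[symmetric] by (simp add: algebra_simps)
      show ?thesis
        unfolding odd_cycle_poly_def sum_divide_distrib atMost_atLeast0 \<delta>_def d_eq pw by (simp add: mult.assoc)
    qed
    finally show ?thesis by (simp add: sumU)
  qed
  \<comment> \<open>Comparison in \<open>k\<close> for fixed \<open>l\<close>: the values
    \<open>V n (inv \<pi>) l\<close> and the powers of \<open>2 l\<close> act as
    coefficients.\<close>
  have fst: "(\<Sum>\<pi>\<in>perms n. V n (inv \<pi>) l * s ^ lpk n \<pi>) =
      (\<Sum>j=0..n. \<delta> j * (2 * of_nat l) ^ j * (1 - s) ^ ((n - j) div 2) * A j)" for l
    unfolding A_def
  proof (rule polynomial_identity_from_coefficients[where c = U and K = "inverse (1 - fps_X)"])
    show "inverse (1 - fps_X :: 'a fps) \<noteq> 0" using inverse_one_minus_X[where 'a = 'a] by auto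
    show "Abs_fps (U j \<pi>) = inverse (1 - fps_X) * fps_R ^ j * fps_S ^ lpk j \<pi>"
      if "j \<ge> 1" "\<pi> \<in> perms j" for j \<pi>
      using fps_super_words_lpk[OF that] by (simp add: U_def[abs_def])
  qed (use assms \<delta>0 key in auto)
  \<comment> \<open>Comparison in \<open>l\<close>: now the terms in \<open>s\<close> are
    coefficients, and \<open>sumV\<close> resolves \<open>(2 l) ^ j\<close>.\<close>
  have "(\<Sum>\<sigma>\<in>perms n. s ^ lpk n (inv \<sigma>) * t ^ (pk n \<sigma> + 1)) =
      (\<Sum>j=0..n. \<delta> j * (1 - s) ^ ((n - j) div 2) * A j * (1 - t) ^ ((n - j) div 2) * B j)"
    unfolding B_def
  proof (rule polynomial_identity_from_coefficients[where c = V and K = "fps_const (1/2) * fps_R"])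
    show "fps_const (1/2) * fps_R \<noteq> (0 :: 'a fps)" using fps_R_neq_0 by simp
    show "Abs_fps (V j \<pi>) = fps_const (1/2) * fps_R * fps_R ^ j * fps_S ^ (pk j \<pi> + 1)"
      if "j \<ge> 1" "\<pi> \<in> perms j" for j \<pi>
      using fps_super_words_pk[OF that] by (simp add: V_def[abs_def])
    show "(\<Sum>\<pi>\<in>perms n. s ^ lpk n (inv \<pi>) * V n \<pi> l) =
        (\<Sum>j=0..n. \<delta> j * (1 - s) ^ ((n - j) div 2) * A j * (\<Sum>\<sigma>\<in>perms j. V j \<sigma> l))" for l
      using fst[of l] reindex[of "\<lambda>\<sigma> \<pi>. s ^ lpk n \<pi> * V n \<sigma> l"] by (simp add: sumV mult_ac)
  qed (use assms \<delta>0 in auto)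
  moreover have "P_lpk_ipk n s t = (\<Sum>\<sigma>\<in>perms n. s ^ lpk n (inv \<sigma>) * t ^ (pk n \<sigma> + 1))"
    unfolding P_lpk_ipk_def ipk_def
    by (rule reindex[symmetric, of "\<lambda>\<sigma> \<pi>. s ^ lpk n \<pi> * t ^ (pk n \<sigma> + 1)"])
  moreover have "\<delta> j * (1 - s) ^ ((n - j) div 2) * A j * (1 - t) ^ ((n - j) div 2) * B j =
      1 / fact n * (of_nat (d n j) * ((1 - s) * (1 - t)) ^ ((n - j) div 2) * P_lpk j s * P_pk j t)"
    if "j \<in> {0..n}" for j
  \<comment> \<open>At \<open>j = 0\<close> the value \<open>P_pk 0 t = 1\<close> differs from
    \<open>B 0 = t\<close>, but the coefficient is 0 since \<open>n\<close> is positive.\<close>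
  proof (cases "j = 0")
    case True
    then have "\<delta> j = 0" using \<delta>0 by simp
    then show ?thesis by (auto simp: \<delta>_def)
  next
    case False
    then show ?thesis
      by (simp add: P_lpk_def P_pk_def A_def B_def \<delta>_def power_mult_distrib)
  qed
  ultimately show ?thesis by (simp add: sum_distrib_left)
qed

end
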